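(* Let $V\in L^\infty(\mathbb{R})\cap C^0(\mathbb{R})$ satisfy $0<v_0\le V(x)\le v_1$ for $x\in\mathbb{R}$, for some constants $v_0,v_1$, and let $a\in\mathbb{R}$. Then each of the following three conditions is equivalent to the condition $$F'(a)=0\quad\text{and}\quad F''(a)\ge 0 :$$ 1. $-\ell_+'(a)=\ell_-'(a)\ge\sqrt{V(a)}$; 2. $h_+'(a)H_+(a)=-1$ and $\ell_+''(a)\le 0$; 3. $h_-'(a)H_-(a)=1$ and $\ell_-''(a)\le 0$.
   Context: All function spaces are real-valued, $H^1(\mathbb{R})=W^{1,2}(\mathbb{R})$, and Sobolev functions are identified with their continuous representatives. Write $\|u\|_\infty=\|u\|_{L^\infty(\mathbb{R})}$ and $\|u\|_V^2=\int_{\mathbb{R}}(|u'|^2+V|u|^2)\,dx$. For $a\in\mathbb{R}$ set $K_a:=\{u\in H^1(\mathbb{R}):\ u(a)=\|u\|_\infty=1\}$ and $F(a):=\inf_{u\in K_a}\|u\|_V^2$; for continuous $V$ as in the claim, $F\in C^2(\mathbb{R})$. Let $\varphi_+,\varphi_-\in W^{2,\infty}_{loc}(\mathbb{R})$ be the (existing, unique, positive) functions satisfying $\varphi_\pm''=V\varphi_\pm$ a.e. in $\mathbb{R}$, $\varphi_\pm(0)=1$, $\lim_{x\to+\infty}\varphi_+(x)=0$ and $\lim_{x\to-\infty}\varphi_-(x)=0$. Define $$h_\pm(x):=\varphi_\pm(x)^2,\quad \ell_\pm(x):=\log\varphi_\pm(x),\quad H_+(x):=\int_{-\infty}^x\frac{1}{h_+(\xi)}\,d\xi,\quad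 H_-(x):=\int_x^\infty\frac{1}{h_-(\xi)}\,d\xi,$$ where the integrals converge. *)

theory Defs
  imports "HOL-Probability.Essential_Supremum" "HOL-Analysis.Analysis"
begin

text \<open>
  Elements of the function spaces below are Borel functions rather than equivalence
  classes modulo null sets; nothing depends on the choice of the representative.
\<close>

definition L2 :: "(real \<Rightarrow> real) set" where
  "L2 = {f \<in> borel_measurable borel. integrable lborel (\<lambda>x. (f x)\<^sup>2)}"

definition Linf_norm :: "(real \<Rightarrow> real) \<Rightarrow> ereal" where
  "Linf_norm f = esssup lborel (\<lambda>x. ereal \<bar>f x\<bar>)"

definition Linf :: "(real \<Rightarrow> real) set" where
  "Linf = {f \<in> borel_measurable borel. Linf_norm f < \<infinity>}"

definition Linf_loc :: "(real \<Rightarrow> real) set" where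
  "Linf_loc = {f \<in> borel_measurable borel.
     \<forall>K. compact K \<longrightarrow> (\<lambda>x. indicator K x * f x) \<in> Linf}"

definition L1_loc :: "(real \<Rightarrow> real) set" where
  "L1_loc = {f \<in> borel_measurable borel. \<forall>K. compact K \<longrightarrow> set_integrable lborel K f}"

definition test_function :: "(real \<Rightarrow> real) \<Rightarrow> bool" where
  "test_function \<psi> \<longleftrightarrow> \<psi> C1_differentiable_on UNIV \<and> compact (closure {x. \<psi> x \<noteq> 0})"

text \<open>
  The weak derivative on the line, with test functions of class $C^1_c$ as in Brezis,
  Functional Analysis, Sobolev Spaces and Partial Differential Equations, Chapter 8;
  by mollification, $C^\infty_c$ gives the same notion.
\<close>

definition has_weak_deriv :: "(real \<Rightarrow> real) \<Rightarrow> (real \<Rightarrow> real) \<Rightarrow> bool" where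
  "has_weak_deriv f g \<longleftrightarrow> f \<in> L1_loc \<and> g \<in> L1_loc \<and>
     (\<forall>\<psi>. test_function \<psi> \<longrightarrow>
        (\<integral>x. f x * deriv \<psi> x \<partial>lborel) = - (\<integral>x. g x * \<psi> x \<partial>lborel))"

text \<open>Determined only up to null sets, and only meaningful if a weak derivative exists.\<close>

definition weak_deriv :: "(real \<Rightarrow> real) \<Rightarrow> real \<Rightarrow> real" where
  "weak_deriv f = (SOME g. has_weak_deriv f g)"

text \<open>In the two Sobolev spaces, functions are their continuous representatives.\<close>

definition H1 :: "(real \<Rightarrow> real) set" where
  "H1 = {u \<in> L2. continuous_on UNIV u \<and> (\<exists>g \<in> L2. has_weak_deriv u g)}"

definition W2inf_loc :: "(real \<Rightarrow> real) set" where
  "W2inf_loc = {u \<in> Linf_loc. continuous_on UNIV u \<and>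
     (\<exists>g \<in> Linf_loc. has_weak_deriv u g \<and> (\<exists>k \<in> Linf_loc. has_weak_deriv g k))}"

definition norm_V_sq :: "(real \<Rightarrow> real) \<Rightarrow> (real \<Rightarrow> real) \<Rightarrow> real" where
  "norm_V_sq V u = (\<integral>x. \<bar>weak_deriv u x\<bar>\<^sup>2 + V x * \<bar>u x\<bar>\<^sup>2 \<partial>lborel)"

definition K :: "real \<Rightarrow> (real \<Rightarrow> real) set" where
  "K a = {u \<in> H1. u a = 1 \<and> Linf_norm u = 1}"

definition F :: "(real \<Rightarrow> real) \<Rightarrow> real \<Rightarrow> real" where
  "F V a = (INF u \<in> K a. norm_V_sq V u)"

definition solves_ode :: "(real \<Rightarrow> real) \<Rightarrow> (real \<Rightarrow> real) \<Rightarrow> bool" where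
  "solves_ode V \<phi> \<longleftrightarrow> \<phi> \<in> W2inf_loc \<and>
     (AE x in lborel. weak_deriv (weak_deriv \<phi>) x = V x * \<phi> x)"

definition is_phi_plus :: "(real \<Rightarrow> real) \<Rightarrow> (real \<Rightarrow> real) \<Rightarrow> bool" where
  "is_phi_plus V \<phi> \<longleftrightarrow> solves_ode V \<phi> \<and> \<phi> 0 = 1 \<and> (\<phi> \<longlongrightarrow> 0) at_top"

definition is_phi_minus :: "(real \<Rightarrow> real) \<Rightarrow> (real \<Rightarrow> real) \<Rightarrow> bool" where
  "is_phi_minus V \<phi> \<longleftrightarrow> solves_ode V \<phi> \<and> \<phi> 0 = 1 \<and> (\<phi> \<longlongrightarrow> 0) at_bot"

definition h :: "(real \<Rightarrow> real) \<Rightarrow> real \<Rightarrow> real" where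
  "h \<phi> x = (\<phi> x)\<^sup>2"

definition ell :: "(real \<Rightarrow> real) \<Rightarrow> real \<Rightarrow> real" where
  "ell \<phi> x = ln (\<phi> x)"

definition H_plus :: "(real \<Rightarrow> real) \<Rightarrow> real \<Rightarrow> real" where
  "H_plus \<phi> x = (LINT \<xi>:{..x}|lborel. 1 / h \<phi> \<xi>)"

definition H_minus :: "(real \<Rightarrow> real) \<Rightarrow> real \<Rightarrow> real" where
  "H_minus \<phi> x = (LINT \<xi>:{x..}|lborel. 1 / h \<phi> \<xi>)"

end

theory Submission
  imports Defs
begin

text \<open>
  For every real $a$ the constraint $\|u\|_\infty = 1$ in the definition of $F(a)$ is harmless:
  without it, the minimiser of $\|u\|_V^2$ among functions with $u(a) = 1$ solves
  $u'' = Vu$ on both sides of $a$ and decays at infinity, so it is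
  $u_a = \varphi_-/\varphi_-(a)$ on the left and $u_a = \varphi_+/\varphi_+(a)$ on the right of $a$.
  Since $\varphi_-$ increases and $\varphi_+$ decreases, $u_a$ has its maximum $1$ at $a$ and so
  belongs to $K_a$.  Integration by parts gives, with the logarithmic derivatives
  $p = \ell_+' = \varphi_+'/\varphi_+ < 0$ and $q = \ell_-' = \varphi_-'/\varphi_- > 0$,
  the formula $F = q - p$ (lemma \<open>F_eq\<close>).

  Everything else follows from this formula.  Both $p$ and $q$ solve the Riccati equation
  $r' = V - r^2$, hence $F' = p^2 - q^2$, which vanishes exactly where $p = -q$; at such a point
  $F'' = 4q(q^2 - V)$, so $F'' \ge 0$ means $q^2 \ge V$ (lemma \<open>critical_iff\<close>).  This is the first
  condition.  For the other two, constancy of the Wronskian identifies $\varphi_+/\varphi_-$ as a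
  multiple of $H_-$, which yields $H_- = 1/(h_-(q-p))$ and therefore $h_-'H_- = 2q/(q-p)$; this equals
  $1$ exactly when $p = -q$.  The reflection $x \mapsto -x$ exchanges $\varphi_+$ and $\varphi_-$ and gives
  the corresponding identity for $H_+$.  The sign conditions in both cases again say $q^2 \ge V$,
  because $\ell_+'' = V - p^2$ and $\ell_-'' = V - q^2$.

  The analytic work lies in passing between weak and classical derivatives.  A continuous
  function with a weak derivative $g$ satisfies the fundamental theorem of calculus with $g$
  (lemma \<open>weak_deriv_FTC\<close>); this gives uniqueness of the weak derivative almost everywhere,
  the twofold classical differentiability of $\varphi_\pm$ (lemma \<open>solves_ode_classical\<close>), and the
  lower bound for $\|u\|_V^2$ (lemma \<open>norm_V_sq_ge\<close>).
\<close>

section \<open>Spline approximations of steps and point masses\<close>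

lemma truncated_power_has_derivative:
  "((\<lambda>y::real. max 0 y ^ Suc (Suc k)) has_real_derivative real (Suc (Suc k)) * max 0 y ^ Suc k) (at y)"
proof -
  consider "y < 0" | "y = 0" | "y > 0" by linarith
  then show ?thesis
  proof cases
    case 1
    have "((\<lambda>y::real. 0) has_real_derivative real (Suc (Suc k)) * max 0 y ^ Suc k) (at y)"
      using 1 by (simp add: max_def)
    then show ?thesis
      by (rule has_field_derivative_transform_within_open[where S="{..<0}"]) (use 1 in \<open>auto simp: max_def\<close>)
  next
    case 3
    have "((\<lambda>y::real. y ^ Suc (Suc k)) has_real_derivative real (Suc (Suc k)) * max 0 y ^ Suc k) (at y)"
      using DERIV_pow[of "Suc (Suc k)" y] 3 by (simp add: max_def)
    then show ?thesis
      by (rule has_field_derivative_transform_within_open[where S="{0<..}"]) (use 3 in \<open>auto simp: max_def\<close>)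
  next
    case 2
    have "isCont (\<lambda>h::real. max 0 h ^ Suc k) 0"
      by (intro continuous_intros)
    then have "((\<lambda>h::real. max 0 h ^ Suc k) \<longlongrightarrow> 0) (at 0)"
      unfolding isCont_def by simp
    then have "((\<lambda>h::real. (max 0 h ^ Suc (Suc k) - 0) / h) \<longlongrightarrow> 0) (at 0)"
      by (rule Lim_transform_within[OF _ zero_less_one]) (auto simp: max_def)
    then show ?thesis
      unfolding DERIV_def using 2 by simp
  qed
qed

text \<open>
  A second difference of truncated powers.  Differentiation lowers the exponent, and for exponent
  one the result is a hat function supported in $[0,1]$; its first and second antiderivatives are
  thus explicit functions that are constant and affine, respectively, to the right of $1$.
\<close>

definition spline :: "nat \<Rightarrow> real \<Rightarrow> real" where
  "spline k z = max 0 z ^ k - 2 * max 0 (z - 1/2) ^ k + max 0 (z - 1) ^ k"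

lemma spline_has_derivative:
  "(spline (Suc (Suc k)) has_real_derivative real (Suc (Suc k)) * spline (Suc k) z) (at z)"
proof -
  have shift: "((\<lambda>z. max 0 (z - c) ^ Suc (Suc k)) has_real_derivative
          real (Suc (Suc k)) * max 0 (z - c) ^ Suc k) (at z)" for c :: real
    using truncated_power_has_derivative[of k "z + - c"] unfolding DERIV_shift
    by (simp del: power_Suc)
  have "((\<lambda>z. max 0 z ^ Suc (Suc k) - 2 * max 0 (z - 1/2) ^ Suc (Suc k) + max 0 (z - 1) ^ Suc (Suc k))
          has_real_derivative real (Suc (Suc k)) * spline (Suc k) z) (at z)"
    unfolding spline_def
    by (rule derivative_eq_intros truncated_power_has_derivative shift refl)+ (simp add: algebra_simps)
  then show ?thesis
    unfolding spline_def[abs_def] .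
qed

definition bump :: "real \<Rightarrow> real" where "bump z = 4 * spline 1 z"
definition smooth_step :: "real \<Rightarrow> real" where "smooth_step z = 2 * spline 2 z"
definition smooth_ramp :: "real \<Rightarrow> real" where "smooth_ramp z = 2 / 3 * spline 3 z"

lemma smooth_step_has_derivative: "(smooth_step has_real_derivative bump z) (at z)"
  using DERIV_cmult[OF spline_has_derivative[of 0 z], of 2]
  unfolding smooth_step_def[abs_def] bump_def by (simp add: numeral_2_eq_2)

lemma smooth_ramp_has_derivative: "(smooth_ramp has_real_derivative smooth_step z) (at z)"
  using DERIV_cmult[OF spline_has_derivative[of 1 z], of "2/3"]
  unfolding smooth_ramp_def[abs_def] smooth_step_def by (simp add: numeral_2_eq_2 numeral_3_eq_3)

lemma continuous_bump [continuous_intros]: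
  "continuous_on S f \<Longrightarrow> continuous_on S (\<lambda>x. bump (f x))"
  unfolding bump_def spline_def by (intro continuous_intros)

lemma continuous_smooth_step [continuous_intros]:
  "continuous_on S f \<Longrightarrow> continuous_on S (\<lambda>x. smooth_step (f x))"
  unfolding smooth_step_def spline_def by (intro continuous_intros)

lemma bump_bounds: "0 \<le> bump z" "bump z \<le> 2"
  by (auto simp: bump_def spline_def max_def field_simps)

lemma bump_outside: "z \<le> 0 \<or> 1 \<le> z \<Longrightarrow> bump z = 0"
  by (auto simp: bump_def spline_def max_def field_simps)

lemma smooth_step_left: "z \<le> 0 \<Longrightarrow> smooth_step z = 0"
  by (simp add: smooth_step_def spline_def max_def)

lemma smooth_step_right: "1 \<le> z \<Longrightarrow> smooth_step z = 1"
  by (simp add: smooth_step_def spline_def max_def) (simp add: power2_eq_square algebra_simps)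

lemma smooth_ramp_left: "z \<le> 0 \<Longrightarrow> smooth_ramp z = 0"
  by (simp add: smooth_ramp_def spline_def max_def)

lemma smooth_ramp_right: "1 \<le> z \<Longrightarrow> smooth_ramp z = z - 1/2"
  by (simp add: smooth_ramp_def spline_def max_def) (simp add: power3_eq_cube algebra_simps)

lemma mono_smooth_step: "x \<le> y \<Longrightarrow> smooth_step x \<le> smooth_step y"
  using DERIV_nonneg_imp_nondecreasing[of x y smooth_step] smooth_step_has_derivative bump_bounds(1) by blast

lemma smooth_step_bounds: "0 \<le> smooth_step z" "smooth_step z \<le> 1"
  using mono_smooth_step[of "min z 0" z] mono_smooth_step[of z "max z 1"]
  by (simp_all add: smooth_step_left smooth_step_right)

lemma integral_bump: "(\<integral>z. bump z \<partial>lborel) = 1"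
proof -
  have "(\<integral>z. bump z * indicator {0..1} z \<partial>lborel) = smooth_step 1 - smooth_step 0"
    by (rule integral_FTC_Icc_real)
      (use continuous_bump[OF continuous_on_id, of UNIV] in \<open>auto intro: smooth_step_has_derivative simp: continuous_on_eq_continuous_at\<close>)
  moreover have "bump z * indicator {0..1} z = bump z" for z
    using bump_outside[of z] by (cases "0 \<le> z \<and> z \<le> 1") (auto simp: indicator_def)
  ultimately show ?thesis
    by (simp add: smooth_step_left smooth_step_right)
qed

lemma continuous_on_of_DERIV:
  assumes "\<And>x::real. (f has_real_derivative f' x) (at x)"
  shows "continuous_on UNIV f"
  using assms DERIV_isCont by (intro continuous_at_imp_continuous_on) auto

section \<open>Test functions and local integrability\<close>

lemma test_functionI:
  assumes D: "\<And>x. (\<psi> has_real_derivative D x) (at x)" and "continuous_on UNIV D"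
    and out: "\<And>x. x < A \<or> B < x \<Longrightarrow> \<psi> x = 0"
  shows "test_function \<psi>" and "deriv \<psi> = D"
proof -
  have "closure {x. \<psi> x \<noteq> 0} \<subseteq> {A..B}"
    by (rule closure_minimal) (use out in \<open>auto simp: not_less[symmetric]\<close>)
  then have "compact (closure {x. \<psi> x \<noteq> 0})"
    using compact_Icc[of A B] by (meson bounded_subset compact_imp_bounded compact_eq_bounded_closed closed_closure)
  moreover have "\<psi> C1_differentiable_on UNIV"
    unfolding C1_differentiable_on_def
    using assms by (auto simp: has_real_derivative_iff_has_vector_derivative)
  ultimately show "test_function \<psi>"
    unfolding test_function_def by simp
  show "deriv \<psi> = D"
    using D by (auto intro: DERIV_imp_deriv)
qed

lemma test_functionE:
  assumes "test_function \<psi>"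
  obtains R where "0 < R" "\<And>x. (\<psi> has_real_derivative deriv \<psi> x) (at x)"
    "continuous_on UNIV (deriv \<psi>)" "\<And>x. x \<notin> {-R<..<R} \<Longrightarrow> \<psi> x = 0"
    "\<And>x. x \<notin> {-R..R} \<Longrightarrow> deriv \<psi> x = 0"
proof -
  obtain D where D: "\<And>x. (\<psi> has_real_derivative D x) (at x)" and contD: "continuous_on UNIV D"
    using assms unfolding test_function_def C1_differentiable_on_def
    by (auto simp: has_real_derivative_iff_has_vector_derivative)
  have dD: "deriv \<psi> = D"
    using D by (auto intro: DERIV_imp_deriv)
  have "bounded (closure {x. \<psi> x \<noteq> 0})"
    using assms compact_imp_bounded unfolding test_function_def by blast
  then obtain b where b: "\<forall>x\<in>closure {x. \<psi> x \<noteq> 0}. norm x \<le> b"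
    unfolding bounded_iff ..
  define R where "R = \<bar>b\<bar> + 1"
  have out: "\<psi> x = 0" if "x \<notin> {-R<..<R}" for x
  proof (rule ccontr)
    assume "\<psi> x \<noteq> 0"
    then have "x \<in> closure {x. \<psi> x \<noteq> 0}"
      by (intro closure_subset[THEN subsetD]) simp
    from b[rule_format, OF this] that show False
      by (auto simp: R_def)
  qed
  have "D x = 0" if "x \<notin> {-R..R}" for x
  proof -
    have "((\<lambda>x. 0) has_real_derivative D x) (at x)"
      by (rule has_field_derivative_transform_within_open[OF D, of "- {-R..R}"]) (use that out in auto)
    then show ?thesis
      using DERIV_unique DERIV_const by blast
  qed
  with out D contD dD show ?thesis
    by (intro that[of R]) (simp_all add: R_def)
qed

lemma L1_locD:
  assumes "f \<in> L1_loc"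
  shows "f \<in> borel_measurable borel" and "compact C \<Longrightarrow> set_integrable lborel C f"
  using assms by (auto simp: L1_loc_def)

lemma L1_loc_continuous_mult:
  assumes f: "f \<in> L1_loc" and c: "continuous_on UNIV c"
  shows "(\<lambda>x. f x * c x) \<in> L1_loc"
proof -
  note [measurable] = L1_locD(1)[OF f] borel_measurable_continuous_onI[OF c]
  have "set_integrable lborel K (\<lambda>x. f x * c x)" if K: "compact K" for K
  proof -
    have [measurable]: "K \<in> sets borel"
      using K by (simp add: borel_compact)
    have "bounded (c ` K)"
      using K c by (intro compact_imp_bounded compact_continuous_image) (auto intro: continuous_on_subset)
    then obtain B where B: "\<And>x. x \<in> K \<Longrightarrow> \<bar>c x\<bar> \<le> B"
      by (auto simp: bounded_iff)
    have "set_integrable lborel K (\<lambda>x. B * f x)"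
      using L1_locD(2)[OF f K] by simp
    then show ?thesis
      unfolding set_integrable_def
    proof (rule Bochner_Integration.integrable_bound)
      show "AE x in lborel. norm (indicat_real K x *\<^sub>R (f x * c x)) \<le> norm (indicat_real K x *\<^sub>R (B * f x))"
      proof (rule AE_I2)
        fix x
        show "norm (indicat_real K x *\<^sub>R (f x * c x)) \<le> norm (indicat_real K x *\<^sub>R (B * f x))"
          using B[of x] mult_right_mono[of "\<bar>c x\<bar>" "\<bar>B\<bar>" "\<bar>f x\<bar>"]
          by (auto simp: indicator_def abs_mult mult.commute)
      qed
    qed measurable
  qed
  then show ?thesis
    by (simp add: L1_loc_def)
qed

lemma L1_loc_continuous:
  assumes c: "continuous_on UNIV c"
  shows "c \<in> L1_loc"
proof -
  have "(\<lambda>x. 1) \<in> L1_loc"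
    by (auto simp: L1_loc_def set_integrable_def borel_compact intro!: integrable_real_indicator emeasure_compact_finite)
  from L1_loc_continuous_mult[OF this c] show ?thesis by simp
qed

lemma L1_loc_diff:
  assumes "f \<in> L1_loc" "g \<in> L1_loc"
  shows "(\<lambda>x. f x - g x) \<in> L1_loc"
  using assms by (auto simp: L1_loc_def set_integral_diff)

lemma L1_loc_add:
  assumes "f \<in> L1_loc" "g \<in> L1_loc"
  shows "(\<lambda>x. f x + g x) \<in> L1_loc"
  using assms by (auto simp: L1_loc_def set_integral_add)

lemma integrable_L1_loc_mult:
  assumes f: "f \<in> L1_loc" and c: "continuous_on UNIV c" and out: "\<And>x. x \<notin> {A..B} \<Longrightarrow> c x = 0"
  shows "integrable lborel (\<lambda>x. f x * c x)"
proof -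
  have "set_integrable lborel {A..B} (\<lambda>x. f x * c x)"
    by (rule L1_locD(2)[OF L1_loc_continuous_mult[OF f c]]) simp
  moreover have "(\<lambda>x. indicator {A..B} x *\<^sub>R (f x * c x)) = (\<lambda>x. f x * c x)"
    using out by (force simp: indicator_def)
  ultimately show ?thesis
    unfolding set_integrable_def by simp
qed

lemma integrable_test_function:
  assumes f: "f \<in> L1_loc" and "test_function \<psi>"
  shows "integrable lborel (\<lambda>x. f x * \<psi> x)" and "integrable lborel (\<lambda>x. f x * deriv \<psi> x)"
proof -
  from assms(2) obtain R where R: "\<And>x. (\<psi> has_real_derivative deriv \<psi> x) (at x)"
    "continuous_on UNIV (deriv \<psi>)" "\<And>x. x \<notin> {-R<..<R} \<Longrightarrow> \<psi> x = 0"
    "\<And>x. x \<notin> {-R..R} \<Longrightarrow> deriv \<psi> x = 0"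
    by (elim test_functionE) (rule that)
  have "continuous_on UNIV \<psi>"
    by (rule continuous_on_of_DERIV[OF R(1)])
  then show "integrable lborel (\<lambda>x. f x * \<psi> x)"
    by (rule integrable_L1_loc_mult[OF f, where A="-R" and B=R]) (auto intro!: R(3))
  show "integrable lborel (\<lambda>x. f x * deriv \<psi> x)"
    by (rule integrable_L1_loc_mult[OF f R(2,4)])
qed

section \<open>Weak derivatives\<close>

lemma smooth_step_scaled_tendsto:
  "(\<lambda>n. smooth_step (real (Suc n) * y)) \<longlonglongrightarrow> (if 0 < y then 1 else 0)"
proof (cases "0 < y")
  case True
  obtain N where N: "1 < real N * y"
    using reals_Archimedean3[OF True] by blast
  have "smooth_step (real (Suc n) * y) = 1" if "N \<le> n" for n
  proof (rule smooth_step_right)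
    have "real N * y \<le> real (Suc n) * y"
      using that True by (intro mult_right_mono) auto
    then show "1 \<le> real (Suc n) * y"
      using N by linarith
  qed
  then have "eventually (\<lambda>n. smooth_step (real (Suc n) * y) = 1) sequentially"
    unfolding eventually_sequentially by blast
  then show ?thesis
    using True by (simp add: tendsto_eventually)
next
  case False
  then have "smooth_step (real (Suc n) * y) = 0" for n
    by (intro smooth_step_left) (simp add: mult_nonneg_nonpos)
  then show ?thesis
    using False by simp
qed

lemma smooth_step_scaled_right: "1 \<le> y \<Longrightarrow> smooth_step (real (Suc n) * y) = 1"
  using mult_mono[of 1 "real (Suc n)" 1 y] by (intro smooth_step_right) simp

lemma smooth_step_scaled_left: "y \<le> 0 \<Longrightarrow> smooth_step (real (Suc n) * y) = 0"
  by (intro smooth_step_left) (simp add: mult_nonneg_nonpos)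

text \<open>
  The rescaled step differences are continuous functions that tend to the indicator of $[a,b]$
  outside the two endpoints and stay supported in $[a,b+1]$.
\<close>

lemma integral_smooth_plateau_tendsto:
  fixes a b :: real
  assumes g: "g \<in> L1_loc" and "a \<le> b"
  shows "(\<lambda>n. \<integral>x. g x * (smooth_step (real (Suc n) * (x - a)) - smooth_step (real (Suc n) * (x - b))) \<partial>lborel)
           \<longlonglongrightarrow> (LINT x:{a..b}|lborel. g x)"
  unfolding set_lebesgue_integral_def
proof (rule integral_dominated_convergence)
  note [measurable] = L1_locD(1)[OF g]
  have [measurable]: "smooth_step \<in> borel_measurable borel"
    using continuous_smooth_step[OF continuous_on_id, of UNIV] borel_measurable_continuous_onI by auto
  show "(\<lambda>x. indicat_real {a..b} x *\<^sub>R g x) \<in> borel_measurable lborel"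
    by measurable
  show "(\<lambda>x. g x * (smooth_step (real (Suc n) * (x - a)) - smooth_step (real (Suc n) * (x - b))))
      \<in> borel_measurable lborel" for n
    by measurable
  show "integrable lborel (\<lambda>x. norm (indicat_real {a..b + 1} x *\<^sub>R g x))"
    using L1_locD(2)[OF g, of "{a..b+1}"] unfolding set_integrable_def by (intro integrable_norm) simp
  have "AE x in lborel. x \<noteq> a" "AE x in lborel. x \<noteq> b"
    by (rule AE_lborel_singleton)+
  then show "AE x in lborel. (\<lambda>n. g x * (smooth_step (real (Suc n) * (x - a)) - smooth_step (real (Suc n) * (x - b))))
         \<longlonglongrightarrow> indicat_real {a..b} x *\<^sub>R g x"
  proof eventually_elim
    case (elim x)
    have "(\<lambda>n. g x * (smooth_step (real (Suc n) * (x - a)) - smooth_step (real (Suc n) * (x - b))))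
         \<longlonglongrightarrow> g x * ((if 0 < x - a then 1 else 0) - (if 0 < x - b then 1 else 0))"
      by (intro tendsto_intros smooth_step_scaled_tendsto)
    moreover have "g x * ((if 0 < x - a then 1 else 0) - (if 0 < x - b then 1 else 0)) = indicat_real {a..b} x *\<^sub>R g x"
      using elim \<open>a \<le> b\<close> by (auto simp: indicator_def)
    ultimately show ?case by (simp only:)
  qed
  show "AE x in lborel. norm (g x * (smooth_step (real (Suc n) * (x - a)) - smooth_step (real (Suc n) * (x - b))))
         \<le> norm (indicat_real {a..b + 1} x *\<^sub>R g x)" for n
  proof (rule AE_I2)
    fix x
    let ?d = "smooth_step (real (Suc n) * (x - a)) - smooth_step (real (Suc n) * (x - b))"
    have "\<bar>?d\<bar> \<le> 1"
      using smooth_step_bounds[of "real (Suc n) * (x - a)"] smooth_step_bounds[of "real (Suc n) * (x - b)"] by linarith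
    moreover have "?d = 0" if "x \<notin> {a..b+1}"
      using that \<open>a \<le> b\<close> smooth_step_scaled_right[of "x - a" n] smooth_step_scaled_right[of "x - b" n]
        smooth_step_scaled_left[of "x - a" n] smooth_step_scaled_left[of "x - b" n]
      by (auto simp del: of_nat_Suc)
    ultimately show "norm (g x * ?d) \<le> norm (indicat_real {a..b + 1} x *\<^sub>R g x)"
      by (auto simp: abs_mult indicator_def mult_left_le simp del: of_nat_Suc)
  qed
qed

text \<open>
  The substitution $x = a + y/(n+1)$ moves the concentration of the bump at $a$ into the argument of
  $f$, where continuity applies.
\<close>

lemma integral_bump_tendsto:
  fixes a :: real
  assumes f: "continuous_on UNIV f"
  shows "(\<lambda>n. \<integral>x. f x * (real (Suc n) * bump (real (Suc n) * (x - a))) \<partial>lborel) \<longlonglongrightarrow> f a"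
proof -
  have [measurable]: "f \<in> borel_measurable borel" "bump \<in> borel_measurable borel"
    using f continuous_bump[OF continuous_on_id, of UNIV] by (auto intro: borel_measurable_continuous_onI)
  have rescale: "(\<integral>x. f x * (real (Suc n) * bump (real (Suc n) * (x - a))) \<partial>lborel)
      = (\<integral>y. f (a + y / real (Suc n)) * bump y \<partial>lborel)" for n
    by (subst lborel_integral_real_affine[where c="1 / real (Suc n)" and t=a])
       (auto simp del: of_nat_Suc intro!: Bochner_Integration.integral_cong
          simp flip: Bochner_Integration.integral_mult_right_zero)
  have "bounded (f ` {a..a+1})"
    using f by (intro compact_imp_bounded compact_continuous_image) (auto intro: continuous_on_subset)
  then obtain B where "\<forall>x\<in>{a..a+1}. \<bar>f x\<bar> \<le> B"
    by (auto simp: bounded_iff)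
  then have B: "\<bar>f x\<bar> \<le> B" if "x \<in> {a..a+1}" for x
    using that by blast
  have "(\<lambda>n. \<integral>y. f (a + y / real (Suc n)) * bump y \<partial>lborel) \<longlonglongrightarrow> (\<integral>y. f a * bump y \<partial>lborel)"
  proof (rule integral_dominated_convergence)
    show "integrable lborel (\<lambda>x::real. indicat_real {0..1} x * (2 * B))"
      by (intro integrable_mult_left integrable_real_indicator) simp_all
    show "AE y in lborel. (\<lambda>n. f (a + y / real (Suc n)) * bump y) \<longlonglongrightarrow> f a * bump y"
    proof (rule AE_I2)
      fix y
      have "(\<lambda>n. a + y * inverse (real (Suc n))) \<longlonglongrightarrow> a + y * 0"
        by (intro tendsto_intros LIMSEQ_inverse_real_of_nat)
      then have "(\<lambda>n. a + y / real (Suc n)) \<longlonglongrightarrow> a"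
        by (simp add: divide_inverse)
      moreover have "isCont f a"
        using f by (simp add: continuous_on_eq_continuous_at)
      ultimately show "(\<lambda>n. f (a + y / real (Suc n)) * bump y) \<longlonglongrightarrow> f a * bump y"
        by (intro tendsto_mult_right) (rule isCont_tendsto_compose[of a f])
    qed
    show "AE y in lborel. norm (f (a + y / real (Suc n)) * bump y) \<le> indicat_real {0..1} y * (2 * B)" for n
    proof (rule AE_I2)
      fix y
      show "norm (f (a + y / real (Suc n)) * bump y) \<le> indicat_real {0..1} y * (2 * B)"
      proof (cases "y \<in> {0..1}")
        case True
        then have "y / real (Suc n) \<le> 1" "0 \<le> y / real (Suc n)"
          by (auto simp: divide_simps)
        then have "\<bar>f (a + y / real (Suc n))\<bar> * \<bar>bump y\<bar> \<le> B * 2"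
          using bump_bounds[of y] B[of a] by (intro mult_mono B) auto
        then show ?thesis
          using True by (simp add: abs_mult mult.commute del: of_nat_Suc)
      next
        case False
        then have "bump y = 0"
          by (intro bump_outside) auto
        with False show ?thesis by (auto simp: indicator_def)
      qed
    qed
  qed measurable
  also have "(\<integral>y. f a * bump y \<partial>lborel) = f a"
    by (simp add: integral_bump)
  finally show ?thesis
    unfolding rescale .
qed

lemma scaled_smooth_step_has_derivative:
  "((\<lambda>x. smooth_step (m * (x - a))) has_real_derivative m * bump (m * (x - a))) (at x)"
proof -
  have "((\<lambda>x. m * (x - a)) has_real_derivative m) (at x)"
    by (auto intro!: derivative_eq_intros)
  from DERIV_chain2[OF smooth_step_has_derivative this] show ?thesis
    by (simp add: mult.commute)
qed

lemma scaled_smooth_ramp_has_derivative: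
  "m \<noteq> 0 \<Longrightarrow> ((\<lambda>x. smooth_ramp (m * (x - a)) / m) has_real_derivative smooth_step (m * (x - a))) (at x)"
proof -
  assume "m \<noteq> 0"
  have "((\<lambda>x. m * (x - a)) has_real_derivative m) (at x)"
    by (auto intro!: derivative_eq_intros)
  from DERIV_cdivide[OF DERIV_chain2[OF smooth_ramp_has_derivative this], of m] \<open>m \<noteq> 0\<close> show ?thesis
    by simp
qed

lemma has_weak_derivD:
  assumes "has_weak_deriv f g"
  shows "f \<in> L1_loc" "g \<in> L1_loc"
    "test_function \<psi> \<Longrightarrow> (\<integral>x. f x * deriv \<psi> x \<partial>lborel) = - (\<integral>x. g x * \<psi> x \<partial>lborel)"
  using assms by (auto simp: has_weak_deriv_def)

text \<open>
  Testing with smoothed indicators of $[a,b]$: their derivatives are approximate point masses at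
  $a$ and $b$, while they themselves converge to the indicator.  Continuity of $f$ makes the
  point values meaningful.
\<close>

theorem weak_deriv_FTC:
  assumes fg: "has_weak_deriv f g" and f: "continuous_on UNIV f" and "a \<le> b"
  shows "(LINT x:{a..b}|lborel. g x) = f b - f a"
proof -
  define \<psi> where "\<psi> n x = smooth_step (real (Suc n) * (x - a)) - smooth_step (real (Suc n) * (x - b))" for n x
  let ?d = "\<lambda>c n x. real (Suc n) * bump (real (Suc n) * (x - c))"
  note L1 = has_weak_derivD(1,2)[OF fg]
  have deriv: "(\<psi> n has_real_derivative ?d a n x - ?d b n x) (at x)" for n x
    unfolding \<psi>_def by (intro DERIV_diff scaled_smooth_step_has_derivative)
  have cont: "continuous_on UNIV (?d c n)" for c n
    by (intro continuous_intros)
  have out: "\<psi> n x = 0" if "x < a \<or> b + 1 < x" for n x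
    using that \<open>a \<le> b\<close> smooth_step_scaled_right[of "x - a" n] smooth_step_scaled_right[of "x - b" n]
        smooth_step_scaled_left[of "x - a" n] smooth_step_scaled_left[of "x - b" n]
    by (auto simp: \<psi>_def simp del: of_nat_Suc)
  have test: "test_function (\<psi> n)" and deriv_eq: "deriv (\<psi> n) = (\<lambda>x. ?d a n x - ?d b n x)" for n
    using test_functionI[OF deriv continuous_on_diff[OF cont cont] out] by blast+
  have "integrable lborel (\<lambda>x. f x * ?d c n x)" for c n
  proof (rule integrable_L1_loc_mult[OF L1(1) cont])
    fix x assume "x \<notin> {c..c+1}"
    then have "real (Suc n) * (x - c) \<le> 0 \<or> 1 \<le> real (Suc n) * (x - c)"
      using mult_mono[of 1 "real (Suc n)" 1 "x - c"] by (auto simp: mult_nonneg_nonpos not_le simp del: of_nat_Suc)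
    then show "?d c n x = 0"
      by (simp add: bump_outside del: of_nat_Suc)
  qed
  then have "(\<integral>x. f x * deriv (\<psi> n) x \<partial>lborel) = (\<integral>x. f x * ?d a n x \<partial>lborel) - (\<integral>x. f x * ?d b n x \<partial>lborel)" for n
    unfolding deriv_eq right_diff_distrib[of "f _"] by (intro Bochner_Integration.integral_diff)
  then have "(\<lambda>n. \<integral>x. f x * deriv (\<psi> n) x \<partial>lborel) \<longlonglongrightarrow> f a - f b"
    using tendsto_diff[OF integral_bump_tendsto[OF f, of a] integral_bump_tendsto[OF f, of b]] by presburger
  moreover have "(\<lambda>n. - (\<integral>x. g x * \<psi> n x \<partial>lborel)) \<longlonglongrightarrow> - (LINT x:{a..b}|lborel. g x)"
    unfolding \<psi>_def by (intro tendsto_minus integral_smooth_plateau_tendsto L1 \<open>a \<le> b\<close>)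
  ultimately have "f a - f b = - (LINT x:{a..b}|lborel. g x)"
    unfolding has_weak_derivD(3)[OF fg test] by (rule LIMSEQ_unique)
  then show ?thesis by simp
qed

lemma has_weak_deriv_diff:
  assumes "has_weak_deriv f g" "has_weak_deriv f' g'"
  shows "has_weak_deriv (\<lambda>x. f x - f' x) (\<lambda>x. g x - g' x)"
  using assms
  by (simp add: has_weak_deriv_def L1_loc_diff left_diff_distrib integrable_test_function Bochner_Integration.integral_diff)

lemma has_weak_deriv_cong_AE:
  assumes "has_weak_deriv f g" and "AE x in lborel. f x = f' x" "AE x in lborel. g x = g' x"
    and "f' \<in> L1_loc" "g' \<in> L1_loc"
  shows "has_weak_deriv f' g'"
  unfolding has_weak_deriv_def
proof (intro conjI allI impI)
  fix \<psi> assume \<psi>: "test_function \<psi>"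
  note [measurable] = has_weak_derivD(1,2)[OF assms(1), THEN L1_locD(1)] assms(4,5)[THEN L1_locD(1)]
  have "(\<integral>x. f' x * deriv \<psi> x \<partial>lborel) = (\<integral>x. f x * deriv \<psi> x \<partial>lborel)"
    using assms(2) integrable_test_function(2)[OF has_weak_derivD(1)[OF assms(1)] \<psi>] integrable_test_function(2)[OF assms(4) \<psi>]
    by (intro integral_cong_AE) auto
  moreover have "(\<integral>x. g' x * \<psi> x \<partial>lborel) = (\<integral>x. g x * \<psi> x \<partial>lborel)"
    using assms(3) integrable_test_function(1)[OF has_weak_derivD(2)[OF assms(1)] \<psi>] integrable_test_function(1)[OF assms(5) \<psi>]
    by (intro integral_cong_AE) auto
  ultimately show "(\<integral>x. f' x * deriv \<psi> x \<partial>lborel) = - (\<integral>x. g' x * \<psi> x \<partial>lborel)"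
    using has_weak_derivD(3)[OF assms(1) \<psi>] by simp
qed fact+

text \<open>
  An indefinite integral that vanishes identically has derivative zero, and by Lebesgue's
  differentiation theorem this derivative is $d$ almost everywhere.
\<close>

lemma L1_loc_eq_0_AE:
  assumes d: "d \<in> L1_loc" and zero: "\<And>a b. a \<le> b \<Longrightarrow> (LINT x:{a..b}|lborel. d x) = 0"
  shows "AE x in lborel. d x = 0"
proof -
  have int: "d integrable_on cbox a b" and int_eq: "integral (cbox a b) d = (LINT x:{a..b}|lborel. d x)" for a b
    using set_borel_integral_eq_integral[of "{a..b}" d] L1_locD(2)[OF d, of "{a..b}"] by auto
  obtain N where N: "negligible N"
    and lim: "\<And>x e. \<lbrakk>x \<notin> N; 0 < e\<rbrakk> \<Longrightarrow> \<exists>\<delta>>0. \<forall>h. 0 < h \<and> h < \<delta> \<longrightarrow>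
         norm (integral (cbox x (x + h *\<^sub>R One)) d /\<^sub>R h ^ DIM(real) - d x) < e"
    using integrable_ccontinuous_explicit[OF int] by blast
  have "d x = 0" if x: "x \<notin> N" for x
  proof (rule ccontr)
    assume "d x \<noteq> 0"
    then obtain \<delta> where "\<delta> > 0" and \<delta>: "\<And>h. 0 < h \<Longrightarrow> h < \<delta> \<Longrightarrow>
         norm (integral (cbox x (x + h *\<^sub>R One)) d /\<^sub>R h ^ DIM(real) - d x) < \<bar>d x\<bar>"
      using lim[OF x, of "\<bar>d x\<bar>"] by auto
    from \<delta>[of "\<delta>/2"] \<open>\<delta> > 0\<close> show False
      unfolding int_eq by (simp add: zero)
  qed
  then have "AE x in lebesgue. d x = 0"
    using N by (intro AE_I'[of N]) (auto simp: negligible_iff_null_sets)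
  then show ?thesis
    by (simp add: AE_completion_iff)
qed

text \<open>
  The difference of two weak derivatives is a weak derivative of the continuous function $0$, so its
  integral over every interval vanishes.
\<close>

lemma has_weak_deriv_unique:
  assumes "has_weak_deriv f g" "has_weak_deriv f g'"
  shows "AE x in lborel. g x = g' x"
proof -
  have "has_weak_deriv (\<lambda>x. 0) (\<lambda>x. g x - g' x)"
    using has_weak_deriv_diff[OF assms] by simp
  then have "(LINT x:{a..b}|lborel. g x - g' x) = 0" if "a \<le> b" for a b
    using weak_deriv_FTC[of "\<lambda>x. 0"] that by simp
  then have "AE x in lborel. g x - g' x = 0"
    using assms by (intro L1_loc_eq_0_AE L1_loc_diff) (auto dest: has_weak_derivD)
  then show ?thesis by simp
qed

lemma weak_deriv_AE_eq:
  assumes "has_weak_deriv f g"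
  shows "has_weak_deriv f (weak_deriv f)" and "AE x in lborel. weak_deriv f x = g x"
proof -
  show *: "has_weak_deriv f (weak_deriv f)"
    unfolding weak_deriv_def by (rule someI[of "has_weak_deriv f", OF assms])
  show "AE x in lborel. weak_deriv f x = g x"
    by (rule has_weak_deriv_unique[OF * assms])
qed

text \<open>
  A test function multiplied by a $C^1$ function is again a test function, so the product rule needs
  no approximation.
\<close>

lemma has_weak_deriv_mult_C1:
  assumes fg: "has_weak_deriv f g"
    and \<theta>: "\<And>x. (\<theta> has_real_derivative \<theta>' x) (at x)" and \<theta>': "continuous_on UNIV \<theta>'"
  shows "has_weak_deriv (\<lambda>x. f x * \<theta> x) (\<lambda>x. g x * \<theta> x + f x * \<theta>' x)"
  unfolding has_weak_deriv_def
proof (intro conjI allI impI)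
  have cont: "continuous_on UNIV \<theta>"
    by (rule continuous_on_of_DERIV[OF \<theta>])
  note L1 = has_weak_derivD(1,2)[OF fg]
  show f\<theta>: "(\<lambda>x. f x * \<theta> x) \<in> L1_loc"
    by (intro L1_loc_continuous_mult L1 cont)
  have g\<theta>: "(\<lambda>x. g x * \<theta> x) \<in> L1_loc" and f\<theta>': "(\<lambda>x. f x * \<theta>' x) \<in> L1_loc"
    by (intro L1_loc_continuous_mult L1 cont \<theta>')+
  then show "(\<lambda>x. g x * \<theta> x + f x * \<theta>' x) \<in> L1_loc"
    by (rule L1_loc_add)
  fix \<psi> assume \<psi>: "test_function \<psi>"
  then obtain R where R: "\<And>x. (\<psi> has_real_derivative deriv \<psi> x) (at x)"
    "continuous_on UNIV (deriv \<psi>)" "\<And>x. x \<notin> {-R<..<R} \<Longrightarrow> \<psi> x = 0"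
    by (elim test_functionE) (rule that)
  have cont\<psi>: "continuous_on UNIV \<psi>"
    by (rule continuous_on_of_DERIV[OF R(1)])
  have D: "((\<lambda>x. \<theta> x * \<psi> x) has_real_derivative \<theta> x * deriv \<psi> x + \<theta>' x * \<psi> x) (at x)" for x
    using DERIV_mult[OF \<theta> R(1)] by (simp add: algebra_simps)
  have contD: "continuous_on UNIV (\<lambda>x. \<theta> x * deriv \<psi> x + \<theta>' x * \<psi> x)"
    by (intro continuous_intros cont cont\<psi> R(2) \<theta>')
  have out: "x < -R \<or> R < x \<Longrightarrow> \<theta> x * \<psi> x = 0" for x
    using R(3) by auto
  have prod: "(\<integral>x. f x * (\<theta> x * deriv \<psi> x + \<theta>' x * \<psi> x) \<partial>lborel) = - (\<integral>x. g x * (\<theta> x * \<psi> x) \<partial>lborel)"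
    using has_weak_derivD(3)[OF fg test_functionI(1)[OF D contD out]] test_functionI(2)[OF D contD out] by simp
  have "(\<integral>x. f x * (\<theta> x * deriv \<psi> x + \<theta>' x * \<psi> x) \<partial>lborel)
      = (\<integral>x. f x * \<theta> x * deriv \<psi> x + f x * \<theta>' x * \<psi> x \<partial>lborel)"
    by (simp add: algebra_simps)
  also have "\<dots> = (\<integral>x. f x * \<theta> x * deriv \<psi> x \<partial>lborel) + (\<integral>x. f x * \<theta>' x * \<psi> x \<partial>lborel)"
    by (intro Bochner_Integration.integral_add integrable_test_function f\<theta> f\<theta>' \<psi>)
  finally have 1: "(\<integral>x. f x * \<theta> x * deriv \<psi> x \<partial>lborel) + (\<integral>x. f x * \<theta>' x * \<psi> x \<partial>lborel) = - (\<integral>x. g x * (\<theta> x * \<psi> x) \<partial>lborel)"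
    using prod by simp
  have "(\<integral>x. (g x * \<theta> x + f x * \<theta>' x) * \<psi> x \<partial>lborel) = (\<integral>x. g x * \<theta> x * \<psi> x \<partial>lborel) + (\<integral>x. f x * \<theta>' x * \<psi> x \<partial>lborel)"
    unfolding distrib_right by (intro Bochner_Integration.integral_add integrable_test_function f\<theta>' g\<theta> \<psi>)
  with 1 show "(\<integral>x. f x * \<theta> x * deriv \<psi> x \<partial>lborel) = - (\<integral>x. (g x * \<theta> x + f x * \<theta>' x) * \<psi> x \<partial>lborel)"
    by (simp add: mult.assoc)
qed

lemma L1_loc_indicator:
  assumes f: "f \<in> L1_loc" and [measurable]: "A \<in> sets borel"
  shows "(\<lambda>x. indicator A x * f x) \<in> L1_loc"
proof -
  note [measurable] = L1_locD(1)[OF f]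
  have "set_integrable lborel C (\<lambda>x. indicator A x * f x)" if "compact C" for C
    using integrable_mult_indicator[of A lborel "\<lambda>x. indicator C x *\<^sub>R f x"] L1_locD(2)[OF f that]
    by (simp add: set_integrable_def mult.left_commute)
  then show ?thesis
    by (simp add: L1_loc_def)
qed

text \<open>
  Integration by parts on either side of $a$ produces the boundary terms $s_1(a)\psi(a)$ and
  $-s_2(a)\psi(a)$, which cancel.  The minimiser $u_a$ has this form.
\<close>

lemma has_weak_deriv_glue:
  fixes s\<^sub>1 s\<^sub>2 d\<^sub>1 d\<^sub>2 :: "real \<Rightarrow> real"
  assumes s: "\<And>x. (s\<^sub>1 has_real_derivative d\<^sub>1 x) (at x)" "\<And>x. (s\<^sub>2 has_real_derivative d\<^sub>2 x) (at x)"
    and d: "continuous_on UNIV d\<^sub>1" "continuous_on UNIV d\<^sub>2" and eq: "s\<^sub>1 a = s\<^sub>2 a"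
  shows "has_weak_deriv (\<lambda>x. if x \<le> a then s\<^sub>1 x else s\<^sub>2 x) (\<lambda>x. if x \<le> a then d\<^sub>1 x else d\<^sub>2 x)"
    (is "has_weak_deriv ?u ?g")
  unfolding has_weak_deriv_def
proof (intro conjI allI impI)
  have cont: "continuous_on UNIV s\<^sub>1" "continuous_on UNIV s\<^sub>2"
    by (rule continuous_on_of_DERIV[OF s(1)], rule continuous_on_of_DERIV[OF s(2)])
  have L1: "(\<lambda>x. if x \<le> a then f\<^sub>1 x else f\<^sub>2 x) \<in> L1_loc"
    if f: "continuous_on UNIV f\<^sub>1" "continuous_on UNIV f\<^sub>2" for f\<^sub>1 f\<^sub>2 :: "real \<Rightarrow> real"
  proof -
    have "(\<lambda>x. if x \<le> a then f\<^sub>1 x else f\<^sub>2 x) = (\<lambda>x. indicator {..a} x * f\<^sub>1 x + indicator {a<..} x * f\<^sub>2 x)"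
      by (auto simp: indicator_def)
    moreover have "(\<lambda>x. indicator {..a} x * f\<^sub>1 x + indicator {a<..} x * f\<^sub>2 x) \<in> L1_loc"
      by (intro L1_loc_add L1_loc_indicator L1_loc_continuous f) auto
    ultimately show ?thesis by simp
  qed
  show u: "?u \<in> L1_loc" and g: "?g \<in> L1_loc"
    using L1 cont d by auto
  fix \<psi> assume \<psi>: "test_function \<psi>"
  then obtain R where R: "0 < R" "\<And>x. (\<psi> has_real_derivative deriv \<psi> x) (at x)"
    "continuous_on UNIV (deriv \<psi>)" "\<And>x. x \<notin> {-R<..<R} \<Longrightarrow> \<psi> x = 0" "\<And>x. x \<notin> {-R..R} \<Longrightarrow> deriv \<psi> x = 0"
    by (elim test_functionE) (rule that)
  have cont\<psi>: "continuous_on UNIV \<psi>"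
    by (rule continuous_on_of_DERIV[OF R(2)])
  define M where "M = max R \<bar>a\<bar>"
  have M: "-M \<le> a" "a \<le> M" "R \<le> M" "\<psi> (-M) = 0" "\<psi> M = 0"
    using R(1,4) by (auto simp: M_def)
  let ?e = "\<lambda>s d x. s x * deriv \<psi> x + d x * \<psi> x"
  have part: "has_bochner_integral lborel (\<lambda>x. ?e s d x * indicator {A..B} x) (s B * \<psi> B - s A * \<psi> A)"
    if "A \<le> B" "\<And>x. (s has_real_derivative d x) (at x)" "continuous_on UNIV d" "continuous_on UNIV s" for s d A B
  proof (rule has_bochner_integral_FTC_Icc_real[OF \<open>A \<le> B\<close>])
    show "((\<lambda>x. s x * \<psi> x) has_real_derivative ?e s d x) (at x)" for x
      using DERIV_mult[OF that(2) R(2)] by (simp add: algebra_simps)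
    have "continuous_on UNIV (?e s d)"
      by (intro continuous_intros that R(3) cont\<psi>)
    then show "isCont (?e s d) x" for x
      by (simp add: continuous_on_eq_continuous_at)
  qed
  have sum: "has_bochner_integral lborel (\<lambda>x. ?e s\<^sub>1 d\<^sub>1 x * indicator {-M..a} x + ?e s\<^sub>2 d\<^sub>2 x * indicator {a..M} x) 0"
    using has_bochner_integral_add[OF part[OF M(1) s(1) d(1) cont(1)] part[OF M(2) s(2) d(2) cont(2)]] M(4,5) eq by simp
  note int = integrable_test_function(2)[OF u \<psi>] integrable_test_function(1)[OF g \<psi>]
  have "(\<integral>x. ?u x * deriv \<psi> x \<partial>lborel) + (\<integral>x. ?g x * \<psi> x \<partial>lborel) = (\<integral>x. ?u x * deriv \<psi> x + ?g x * \<psi> x \<partial>lborel)"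
    by (rule Bochner_Integration.integral_add[symmetric, OF int])
  also have "\<dots> = (\<integral>x. ?e s\<^sub>1 d\<^sub>1 x * indicator {-M..a} x + ?e s\<^sub>2 d\<^sub>2 x * indicator {a..M} x \<partial>lborel)"
  proof (rule integral_cong_AE)
    show "(\<lambda>x. ?u x * deriv \<psi> x + ?g x * \<psi> x) \<in> borel_measurable lborel"
      using int by (intro borel_measurable_add) auto
    show "(\<lambda>x. ?e s\<^sub>1 d\<^sub>1 x * indicator {-M..a} x + ?e s\<^sub>2 d\<^sub>2 x * indicator {a..M} x) \<in> borel_measurable lborel"
      using sum by (auto dest: borel_measurable_has_bochner_integral)
    have "AE x in lborel. x \<noteq> a"
      by (rule AE_lborel_singleton)
    then show "AE x in lborel. ?u x * deriv \<psi> x + ?g x * \<psi> x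
        = ?e s\<^sub>1 d\<^sub>1 x * indicator {-M..a} x + ?e s\<^sub>2 d\<^sub>2 x * indicator {a..M} x"
    proof eventually_elim
      case (elim x)
      have "\<psi> x = 0 \<and> deriv \<psi> x = 0" if "x \<notin> {-M..M}"
        using that R(4,5)[of x] M(3) by auto
      then show ?case
        using elim M(1,2) by (cases "x \<in> {-M..M}") (auto simp: indicator_def)
    qed
  qed
  also have "\<dots> = 0"
    using sum by (rule has_bochner_integral_integral_eq)
  finally show "(\<integral>x. ?u x * deriv \<psi> x \<partial>lborel) = - (\<integral>x. ?g x * \<psi> x \<partial>lborel)"
    by simp
qed

lemma has_weak_deriv_C1:
  assumes "\<And>x. (s has_real_derivative d x) (at x)" "continuous_on UNIV d"
  shows "has_weak_deriv s d"
  using has_weak_deriv_glue[where s\<^sub>1=s and s\<^sub>2=s and d\<^sub>1=d and d\<^sub>2=d] assms by simp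

section \<open>Regularity of solutions of the differential equation\<close>

text \<open>
  The function $w$ need not be continuous, so \<open>weak_deriv_FTC\<close> does not apply to it.  Instead,
  the indicator of $[a,b]$ minus $(b-a)$ times a fixed bump of mass one has integral zero, hence
  is, after smoothing, the derivative of a test function.  Therefore the integral of $w$ over $[a,b]$
  is $(b-a)$ times a constant, and that integral is the increment of $\theta$.
\<close>

lemma affine_of_weak_deriv2_0:
  assumes \<theta>w: "has_weak_deriv \<theta> w" and \<theta>: "continuous_on UNIV \<theta>" and w0: "has_weak_deriv w (\<lambda>x. 0)"
  obtains c where "\<And>x. \<theta> x = \<theta> 0 + c * x"
proof -
  define c where "c = (\<integral>x. w x * bump x \<partial>lborel)"
  note w = has_weak_derivD(2)[OF \<theta>w]
  have bump: "integrable lborel (\<lambda>x. w x * bump x)"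
    by (rule integrable_L1_loc_mult[OF w, of bump 0 1])
      (use continuous_bump[OF continuous_on_id, of UNIV] bump_outside in auto)
  have "\<theta> b - \<theta> a = (b - a) * c" if "a \<le> b" for a b
  proof -
    let ?p = "\<lambda>n x. smooth_step (real (Suc n) * (x - a)) - smooth_step (real (Suc n) * (x - b))"
    let ?r = "\<lambda>c n x. smooth_ramp (real (Suc n) * (x - c)) / real (Suc n)"
    have plateau: "(\<integral>x. w x * ?p n x \<partial>lborel) = (b - a) * c" for n
    proof -
      have contp: "continuous_on UNIV (?p n)"
        by (intro continuous_intros)
      have D: "((\<lambda>x. ?r a n x - ?r b n x - (b - a) * smooth_step x) has_real_derivative
            ?p n x - (b - a) * bump x) (at x)" for x
        by (intro DERIV_diff DERIV_cmult scaled_smooth_ramp_has_derivative smooth_step_has_derivative) simp_all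
      have cont: "continuous_on UNIV (\<lambda>x. ?p n x - (b - a) * bump x)"
        by (intro continuous_intros)
      have out: "?r a n x - ?r b n x - (b - a) * smooth_step x = 0"
        if "x < min a 0 \<or> max (b + 1) 1 < x" for x
      proof -
        from that consider "x < min a 0" | "max (b + 1) 1 < x" by blast
        then show ?thesis
        proof cases
          case 1
          then have "real (Suc n) * (x - a) \<le> 0" "real (Suc n) * (x - b) \<le> 0"
            using \<open>a \<le> b\<close> by (auto intro!: mult_nonneg_nonpos)
          with 1 show ?thesis
            by (simp add: smooth_ramp_left smooth_step_left del: of_nat_Suc)
        next
          case 2
          then have "1 \<le> real (Suc n) * (x - a)" "1 \<le> real (Suc n) * (x - b)"
            using \<open>a \<le> b\<close> mult_mono[of 1 "real (Suc n)" 1 "x - a"] mult_mono[of 1 "real (Suc n)" 1 "x - b"] by auto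
          with 2 show ?thesis
            by (simp add: smooth_ramp_right smooth_step_right diff_divide_distrib del: of_nat_Suc)
        qed
      qed
      have "(\<integral>x. w x * (?p n x - (b - a) * bump x) \<partial>lborel) = 0"
      proof -
        have "test_function (\<lambda>x. ?r a n x - ?r b n x - (b - a) * smooth_step x)"
          by (rule test_functionI(1)[OF D cont]) (rule out)
        moreover have "deriv (\<lambda>x. ?r a n x - ?r b n x - (b - a) * smooth_step x) = (\<lambda>x. ?p n x - (b - a) * bump x)"
          by (rule test_functionI(2)[OF D cont]) (rule out)
        ultimately show ?thesis
          using has_weak_derivD(3)[OF w0] by fastforce
      qed
      moreover have "integrable lborel (\<lambda>x. w x * ?p n x)"
      proof (rule integrable_L1_loc_mult[OF w contp])
        show "?p n x = 0" if "x \<notin> {a..b + 1}" for x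
          using that \<open>a \<le> b\<close> smooth_step_scaled_right[of "x - a" n] smooth_step_scaled_right[of "x - b" n]
            smooth_step_scaled_left[of "x - a" n] smooth_step_scaled_left[of "x - b" n]
          by (auto simp del: of_nat_Suc)
      qed
      then have "(\<integral>x. w x * ?p n x - (b - a) * (w x * bump x) \<partial>lborel) = (\<integral>x. w x * ?p n x \<partial>lborel) - (b - a) * c"
        unfolding c_def using bump
        by (subst Bochner_Integration.integral_diff) (auto simp del: of_nat_Suc)
      ultimately show ?thesis
        by (simp add: right_diff_distrib mult.left_commute del: of_nat_Suc)
    qed
    have "(\<lambda>n. \<integral>x. w x * ?p n x \<partial>lborel) \<longlonglongrightarrow> (LINT x:{a..b}|lborel. w x)"
      by (rule integral_smooth_plateau_tendsto[OF w \<open>a \<le> b\<close>])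
    then have "(LINT x:{a..b}|lborel. w x) = (b - a) * c"
      unfolding plateau by (rule LIMSEQ_unique[OF _ tendsto_const])
    then show ?thesis
      using weak_deriv_FTC[OF \<theta>w \<theta> \<open>a \<le> b\<close>] by simp
  qed
  note diff = this
  have "\<theta> x = \<theta> 0 + c * x" for x
    using diff[of 0 x] diff[of x 0] by (cases "0 \<le> x") (simp_all add: algebra_simps)
  then show ?thesis by (rule that)
qed

lemma antiderivative_of_continuous:
  fixes f :: "real \<Rightarrow> real"
  assumes "continuous_on UNIV f"
  obtains G where "\<And>x. (G has_real_derivative f x) (at x)"
proof -
  have "isCont f x" for x
    using assms by (simp add: continuous_on_eq_continuous_at)
  then have "\<exists>G. \<forall>x. - \<infinity> < ereal x \<longrightarrow> ereal x < \<infinity> \<longrightarrow> (G has_vector_derivative f x) (at x)"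
    by (intro einterval_antiderivative) simp_all
  then obtain G where "\<forall>x. (G has_vector_derivative f x) (at x)"
    by auto
  then show ?thesis
    by (intro that[of G]) (simp add: has_real_derivative_iff_has_vector_derivative)
qed

text \<open>
  Integrating the continuous function $V\varphi$ twice gives a $C^2$ function $\Phi$ with
  $\Phi'' = V\varphi$; the difference $\varphi - \Phi$ has second weak derivative zero, hence is
  affine.
\<close>

lemma solves_ode_classical:
  assumes V: "continuous_on UNIV V" and sol: "solves_ode V \<phi>"
  obtains D where "\<And>x. (\<phi> has_real_derivative D x) (at x)" "\<And>x. (D has_real_derivative V x * \<phi> x) (at x)"
proof -
  from sol obtain g k where gk: "has_weak_deriv \<phi> g" "has_weak_deriv g k" and \<phi>: "continuous_on UNIV \<phi>"
    and ode: "AE x in lborel. weak_deriv (weak_deriv \<phi>) x = V x * \<phi> x"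
    by (auto simp: solves_ode_def W2inf_loc_def)
  define g' where "g' = weak_deriv \<phi>"
  have \<phi>g': "has_weak_deriv \<phi> g'"
    unfolding g'_def by (rule weak_deriv_AE_eq[OF gk(1)])
  have "AE x in lborel. g x = g' x"
    by (rule has_weak_deriv_unique[OF gk(1) \<phi>g'])
  then have "has_weak_deriv g' k"
    using has_weak_derivD[OF \<phi>g'] has_weak_derivD[OF gk(2)]
    by (intro has_weak_deriv_cong_AE[OF gk(2)]) auto
  then have g'k: "has_weak_deriv g' (weak_deriv g')"
    by (rule weak_deriv_AE_eq)
  have contV\<phi>: "continuous_on UNIV (\<lambda>x. V x * \<phi> x)"
    by (intro continuous_intros V \<phi>)
  have g'V: "has_weak_deriv g' (\<lambda>x. V x * \<phi> x)"
    using ode has_weak_derivD[OF \<phi>g'] contV\<phi>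
    by (intro has_weak_deriv_cong_AE[OF g'k]) (auto simp: g'_def L1_loc_continuous)
  obtain \<kappa> where \<kappa>: "\<And>x. (\<kappa> has_real_derivative V x * \<phi> x) (at x)"
    by (rule antiderivative_of_continuous[OF contV\<phi>]) (rule that)
  have cont\<kappa>: "continuous_on UNIV \<kappa>"
    by (rule continuous_on_of_DERIV[OF \<kappa>])
  obtain \<Phi> where \<Phi>: "\<And>x. (\<Phi> has_real_derivative \<kappa> x) (at x)"
    by (rule antiderivative_of_continuous[OF cont\<kappa>]) (rule that)
  have 1: "has_weak_deriv (\<lambda>x. \<phi> x - \<Phi> x) (\<lambda>x. g' x - \<kappa> x)"
    by (rule has_weak_deriv_diff[OF \<phi>g' has_weak_deriv_C1[OF \<Phi> cont\<kappa>]])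
  have 2: "has_weak_deriv (\<lambda>x. g' x - \<kappa> x) (\<lambda>x. 0)"
    using has_weak_deriv_diff[OF g'V has_weak_deriv_C1[OF \<kappa> contV\<phi>]] by simp
  have 3: "continuous_on UNIV (\<lambda>x. \<phi> x - \<Phi> x)"
    by (intro continuous_intros \<phi> continuous_on_of_DERIV[OF \<Phi>])
  obtain c where c: "\<And>x. \<phi> x - \<Phi> x = \<phi> 0 - \<Phi> 0 + c * x"
    by (rule affine_of_weak_deriv2_0[OF 1 3 2]) (rule that)
  have \<phi>_eq: "\<phi> = (\<lambda>x. \<Phi> x + (\<phi> 0 - \<Phi> 0) + c * x)"
    using c by (simp add: fun_eq_iff algebra_simps)
  have "(\<phi> has_real_derivative \<kappa> x + c) (at x)" for x
    by (subst \<phi>_eq) (auto intro!: derivative_eq_intros \<Phi>)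
  moreover have "((\<lambda>x. \<kappa> x + c) has_real_derivative V x * \<phi> x) (at x)" for x
    by (auto intro!: derivative_eq_intros \<kappa>)
  ultimately show ?thesis by (rule that)
qed

section \<open>Solutions that decay at plus infinity\<close>

text \<open>
  Only decay at $+\infty$ is treated; the solution decaying at $-\infty$ becomes an instance after
  reflection.
\<close>

locale decaying_solution =
  fixes V \<phi> D :: "real \<Rightarrow> real" and v\<^sub>0 v\<^sub>1 :: real
  assumes v\<^sub>0_pos: "0 < v\<^sub>0" and V_ge: "v\<^sub>0 \<le> V x" and V_le: "V x \<le> v\<^sub>1"
    and \<phi>_deriv: "(\<phi> has_real_derivative D x) (at x)"
    and D_deriv: "(D has_real_derivative V x * \<phi> x) (at x)"
    and \<phi>_0: "\<phi> 0 = 1"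
    and \<phi>_tendsto: "(\<phi> \<longlongrightarrow> 0) at_top"
begin

lemma V_pos: "0 < V x"
  using v\<^sub>0_pos V_ge[of x] by linarith

lemma \<phi>D_deriv: "((\<lambda>x. \<phi> x * D x) has_real_derivative (D x)\<^sup>2 + V x * (\<phi> x)\<^sup>2) (at x)"
  using DERIV_mult[OF \<phi>_deriv D_deriv] by (simp add: power2_eq_square algebra_simps)

lemma \<phi>_sq_deriv: "((\<lambda>x. (\<phi> x)\<^sup>2) has_real_derivative 2 * (\<phi> x * D x)) (at x)"
  using DERIV_power[OF \<phi>_deriv, of 2] by (simp add: algebra_simps)

lemma \<phi>D_mono: "x \<le> y \<Longrightarrow> \<phi> x * D x \<le> \<phi> y * D y"
proof (rule DERIV_nonneg_imp_nondecreasing[of x y "\<lambda>x. \<phi> x * D x"])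
  fix t
  have "0 \<le> (D t)\<^sup>2 + V t * (\<phi> t)\<^sup>2"
    using V_pos[of t] by (simp add: less_imp_le)
  then show "\<exists>d. ((\<lambda>x. \<phi> x * D x) has_real_derivative d) (at t) \<and> 0 \<le> d"
    using \<phi>D_deriv by blast
qed

text \<open>
  Otherwise $(\varphi^2)' = 2\varphi\varphi'$, being nondecreasing, would stay positive from some point
  on, and $\varphi^2$ could not tend to zero.
\<close>

lemma \<phi>D_nonpos: "\<phi> x * D x \<le> 0"
proof (rule ccontr)
  assume "\<not> \<phi> x * D x \<le> 0"
  then have pos: "0 < \<phi> x * D x" by simp
  have "(\<phi> x)\<^sup>2 \<le> (\<phi> y)\<^sup>2" if "x \<le> y" for y
  proof (rule DERIV_nonneg_imp_nondecreasing[OF that, of "\<lambda>x. (\<phi> x)\<^sup>2"])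
    fix t assume "x \<le> t" "t \<le> y"
    then have "0 \<le> 2 * (\<phi> t * D t)"
      using \<phi>D_mono[of x t] pos by linarith
    then show "\<exists>d. ((\<lambda>x. (\<phi> x)\<^sup>2) has_real_derivative d) (at t) \<and> 0 \<le> d"
      using \<phi>_sq_deriv by blast
  qed
  then have "eventually (\<lambda>y. (\<phi> x)\<^sup>2 \<le> (\<phi> y)\<^sup>2) at_top"
    by (rule eventually_mono[OF eventually_ge_at_top[of x]])
  moreover have "((\<lambda>y. (\<phi> y)\<^sup>2) \<longlongrightarrow> 0) at_top"
    using tendsto_power[OF \<phi>_tendsto, of 2] by simp
  ultimately have "(\<phi> x)\<^sup>2 \<le> 0"
    by (intro tendsto_lowerbound[of "\<lambda>y. (\<phi> y)\<^sup>2" 0 at_top]) simp_all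
  with pos show False by simp
qed

lemma \<phi>_sq_antimono: "x \<le> y \<Longrightarrow> (\<phi> y)\<^sup>2 \<le> (\<phi> x)\<^sup>2"
proof (rule DERIV_nonpos_imp_nonincreasing[of x y "\<lambda>x. (\<phi> x)\<^sup>2"])
  fix t
  show "\<exists>d. ((\<lambda>x. (\<phi> x)\<^sup>2) has_real_derivative d) (at t) \<and> d \<le> 0"
    using \<phi>_sq_deriv[of t] \<phi>D_nonpos[of t] by (intro exI[of _ "2 * (\<phi> t * D t)"] conjI) linarith+
qed

text \<open>
  Since $\varphi^2$ is nonincreasing, a zero propagates to the right, so that $\varphi = \varphi' = 0$
  at some positive point; uniqueness for the initial value problem then contradicts $\varphi(0)=1$.
\<close>

lemma \<phi>_nonzero: "\<phi> x \<noteq> 0"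
proof
  assume x: "\<phi> x = 0"
  have zero: "\<phi> y = 0" if "x \<le> y" for y
    using \<phi>_sq_antimono[OF that] x by simp
  have "\<not> x \<le> 0"
    using zero[of 0] \<phi>_0 by auto
  define y where "y = x + 1"
  have "((\<lambda>x. 0) has_real_derivative D y) (at y)"
    by (rule has_field_derivative_transform_within_open[OF \<phi>_deriv, where S="{x<..}"])
      (auto simp: y_def zero)
  then have "D y = 0"
    using DERIV_unique DERIV_const by blast
  have "\<phi> y = 0"
    by (rule zero) (simp add: y_def)
  \<comment> \<open>Gronwall: $(\varphi^2+\varphi'^2)' \ge -(1+v_1)(\varphi^2+\varphi'^2)$, so the Cauchy data at $0$ vanish as well.\<close>
  let ?E = "\<lambda>t. ((\<phi> t)\<^sup>2 + (D t)\<^sup>2) * exp ((1 + v\<^sub>1) * t)"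
  have "?E 0 \<le> ?E y"
  proof (rule DERIV_nonneg_imp_nondecreasing[of 0 y ?E])
    show "0 \<le> y"
      using \<open>\<not> x \<le> 0\<close> by (simp add: y_def)
    fix t
    let ?d = "(2 * (\<phi> t * D t) * (1 + V t) + (1 + v\<^sub>1) * ((\<phi> t)\<^sup>2 + (D t)\<^sup>2)) * exp ((1 + v\<^sub>1) * t)"
    have "(?E has_real_derivative ?d) (at t)"
      by (auto intro!: derivative_eq_intros \<phi>_deriv D_deriv simp: algebra_simps power2_eq_square)
    moreover have "0 \<le> ?d"
    proof -
      have "- (\<phi> t * D t) * 2 \<le> (\<phi> t)\<^sup>2 + (D t)\<^sup>2"
        using zero_le_power2[of "\<phi> t + D t"] by (simp add: power2_sum)
      then have "(- (\<phi> t * D t) * 2) * (1 + V t) \<le> ((\<phi> t)\<^sup>2 + (D t)\<^sup>2) * (1 + v\<^sub>1)"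
        using V_pos[of t] V_le[of t] by (intro mult_mono) auto
      then show ?thesis
        by (intro mult_nonneg_nonneg) (simp_all add: algebra_simps)
    qed
    ultimately show "\<exists>d. (?E has_real_derivative d) (at t) \<and> 0 \<le> d"
      by blast
  qed
  then show False
    using \<open>\<phi> y = 0\<close> \<open>D y = 0\<close> \<phi>_0 zero_le_power2[of "D 0"] by simp
qed

lemma \<phi>_pos: "0 < \<phi> x"
proof (rule ccontr)
  assume "\<not> 0 < \<phi> x"
  have cont: "continuous_on S \<phi>" for S
    by (rule continuous_on_subset[OF continuous_on_of_DERIV[OF \<phi>_deriv]]) simp
  have "\<exists>z. \<phi> z = 0"
  proof (cases "x \<le> 0")
    case True
    then show ?thesis
      using IVT'[of \<phi> x 0 0] cont \<open>\<not> 0 < \<phi> x\<close> \<phi>_0 by auto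
  next
    case False
    then show ?thesis
      using IVT2'[of \<phi> x 0 0] cont \<open>\<not> 0 < \<phi> x\<close> \<phi>_0 by auto
  qed
  then show False
    using \<phi>_nonzero by blast
qed

lemma D_strict_mono: "x < y \<Longrightarrow> D x < D y"
  by (rule DERIV_pos_imp_increasing[of x y D])
    (use D_deriv mult_pos_pos[OF V_pos \<phi>_pos] in blast)+

lemma D_neg: "D x < 0"
proof -
  have "D (x + 1) \<le> 0"
    using \<phi>D_nonpos[of "x + 1"] \<phi>_pos[of "x + 1"] by (simp add: mult_le_0_iff)
  with D_strict_mono[of x "x + 1"] show ?thesis by simp
qed

lemma \<phi>_antimono: "x \<le> y \<Longrightarrow> \<phi> y \<le> \<phi> x"
  by (rule power2_le_imp_le[OF \<phi>_sq_antimono less_imp_le[OF \<phi>_pos]])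

text \<open>
  As $\varphi'$ is increasing and negative, the mean value theorem bounds it below by the increment of
  $\varphi$ over the preceding unit interval.
\<close>

lemma D_tendsto: "(D \<longlongrightarrow> 0) at_top"
proof (rule tendsto_sandwich[where f="\<lambda>x. \<phi> x - \<phi> (x - 1)" and h="\<lambda>x. 0"])
  have "\<phi> x - \<phi> (x - 1) \<le> D x" for x
  proof -
    obtain z where "x - 1 < z" "z < x" "\<phi> x - \<phi> (x - 1) = (x - (x - 1)) * D z"
      using MVT2[of "x - 1" x \<phi> D] \<phi>_deriv by auto
    then show ?thesis
      using D_strict_mono[of z x] by simp
  qed
  then show "eventually (\<lambda>x. \<phi> x - \<phi> (x - 1) \<le> D x) at_top"
    by simp
  show "eventually (\<lambda>x. D x \<le> 0) at_top"
    using D_neg by (simp add: less_imp_le)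
  have "filterlim (\<lambda>x::real. x - 1) at_top at_top"
    using filterlim_tendsto_add_at_top[OF tendsto_const[of "-1::real"] filterlim_ident] by simp
  then have "((\<lambda>x. \<phi> (x - 1)) \<longlongrightarrow> 0) at_top"
    by (rule filterlim_compose[OF \<phi>_tendsto])
  from tendsto_diff[OF \<phi>_tendsto this] show "((\<lambda>x. \<phi> x - \<phi> (x - 1)) \<longlongrightarrow> 0) at_top"
    by simp
qed simp

lemma cont_\<phi>: "continuous_on S \<phi>" and cont_D: "continuous_on S D"
  by (rule continuous_on_subset[OF continuous_on_of_DERIV[OF \<phi>_deriv]]; simp)
     (rule continuous_on_subset[OF continuous_on_of_DERIV[OF D_deriv]]; simp)

end

section \<open>The minimal energy\<close>

text \<open>
  Expanding $(g-d)^2 + V(u-s)^2 \ge 0$ bounds the energy of $u$ from below by twice its inner product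
  with $s$ minus the energy of $s$.  Because $s$ solves the equation, both are boundary terms;
  the inequality is linear in $u$, so no product of two weakly differentiable functions
  has to be differentiated.
\<close>

lemma quadratic_form_lower_bound:
  fixes u g s d V :: "real \<Rightarrow> real"
  assumes ug: "has_weak_deriv u g" and u: "continuous_on UNIV u" and g2: "integrable lborel (\<lambda>x. (g x)\<^sup>2)"
    and V: "continuous_on UNIV V" and V_pos: "\<And>x. 0 \<le> V x"
    and s: "\<And>x. (s has_real_derivative d x) (at x)" and d: "\<And>x. (d has_real_derivative V x * s x) (at x)"
    and "x \<le> y"
  shows "2 * (u y * d y - u x * d x) - (s y * d y - s x * d x) \<le> (LINT t:{x..y}|lborel. (g t)\<^sup>2 + V t * (u t)\<^sup>2)"
proof -
  have cs: "continuous_on UNIV s" and cd: "continuous_on UNIV d"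
    by (rule continuous_on_of_DERIV[OF s], rule continuous_on_of_DERIV[OF d])
  have cVs: "continuous_on UNIV (\<lambda>x. V x * s x)"
    by (intro continuous_intros V cs)
  have ud: "has_weak_deriv (\<lambda>x. u x * d x) (\<lambda>x. g x * d x + u x * (V x * s x))"
    by (rule has_weak_deriv_mult_C1[OF ug d cVs])
  have sd: "has_weak_deriv (\<lambda>x. s x * d x) (\<lambda>x. d x * d x + s x * (V x * s x))"
    by (rule has_weak_deriv_mult_C1[OF has_weak_deriv_C1[OF s cd] d cVs])
  have B: "(LINT t:{x..y}|lborel. g t * d t + u t * (V t * s t)) = u y * d y - u x * d x"
    by (rule weak_deriv_FTC[OF ud _ \<open>x \<le> y\<close>]) (intro continuous_intros u cd)
  have Q: "(LINT t:{x..y}|lborel. d t * d t + s t * (V t * s t)) = s y * d y - s x * d x"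
    by (rule weak_deriv_FTC[OF sd _ \<open>x \<le> y\<close>]) (intro continuous_intros cs cd)
  have iB: "set_integrable lborel {x..y} (\<lambda>t. g t * d t + u t * (V t * s t))"
    and iQ: "set_integrable lborel {x..y} (\<lambda>t. d t * d t + s t * (V t * s t))"
    using L1_locD(2)[OF has_weak_derivD(2)[OF ud]] L1_locD(2)[OF has_weak_derivD(2)[OF sd]] by auto
  have "continuous_on {x..y} (\<lambda>t. V t * (u t)\<^sup>2)"
    by (intro continuous_intros continuous_on_subset[OF V] continuous_on_subset[OF u]) auto
  then have "set_integrable lborel {x..y} (\<lambda>t. V t * (u t)\<^sup>2)"
    by (rule borel_integrable_atLeastAtMost')
  moreover have "set_integrable lborel {x..y} (\<lambda>t. (g t)\<^sup>2)"
    unfolding set_integrable_def by (intro integrable_mult_indicator g2) simp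
  ultimately have iF: "set_integrable lborel {x..y} (\<lambda>t. (g t)\<^sup>2 + V t * (u t)\<^sup>2)"
    by (intro set_integral_add)
  have "2 * (LINT t:{x..y}|lborel. g t * d t + u t * (V t * s t)) - (LINT t:{x..y}|lborel. d t * d t + s t * (V t * s t))
     = (LINT t:{x..y}|lborel. 2 * (g t * d t + u t * (V t * s t)) - (d t * d t + s t * (V t * s t)))"
    using iB iQ by (subst set_integral_diff) (auto simp del: distrib_left_numeral)
  also have "\<dots> \<le> (LINT t:{x..y}|lborel. (g t)\<^sup>2 + V t * (u t)\<^sup>2)"
  proof (rule set_integral_mono)
    show "set_integrable lborel {x..y} (\<lambda>t. 2 * (g t * d t + u t * (V t * s t)) - (d t * d t + s t * (V t * s t)))"
      by (rule set_integral_diff(1)[OF set_integrable_mult_right[OF iB] iQ])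
    show "2 * (g t * d t + u t * (V t * s t)) - (d t * d t + s t * (V t * s t)) \<le> (g t)\<^sup>2 + V t * (u t)\<^sup>2" for t
    proof -
      have "0 \<le> (g t - d t)\<^sup>2 + V t * (u t - s t)\<^sup>2"
        using V_pos[of t] by simp
      then show ?thesis
        by (simp add: power2_eq_square algebra_simps)
    qed
  qed fact
  finally show ?thesis
    unfolding B Q .
qed

text \<open>
  The condition $|u| \le c$ defines a closed set, and a closed set of full measure is the whole line.
\<close>

lemma Linf_norm_le_iff:
  assumes u: "continuous_on UNIV u"
  shows "Linf_norm u \<le> ereal c \<longleftrightarrow> (\<forall>x. \<bar>u x\<bar> \<le> c)"
proof
  assume le: "Linf_norm u \<le> ereal c"
  have "AE x in lborel. ereal \<bar>u x\<bar> \<le> Linf_norm u"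
    unfolding Linf_norm_def by (rule esssup_AE)
  then have "AE x in lborel. x \<in> {x. \<bar>u x\<bar> \<le> c}"
  proof eventually_elim
    case (elim x)
    then have "ereal \<bar>u x\<bar> \<le> ereal c"
      using le by (rule order_trans)
    then show ?case by simp
  qed
  then have "AE x in lebesgue. x \<in> {x. \<bar>u x\<bar> \<le> c}"
    by (rule AE_completion)
  moreover have "closed {x. \<bar>u x\<bar> \<le> c}"
    by (intro closed_Collect_le continuous_intros u)
  ultimately show "\<forall>x. \<bar>u x\<bar> \<le> c"
    using mem_closed_if_AE_lebesgue by blast
next
  assume le: "\<forall>x. \<bar>u x\<bar> \<le> c"
  have [measurable]: "u \<in> borel_measurable borel"
    using u by (rule borel_measurable_continuous_onI)
  show "Linf_norm u \<le> ereal c"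
    unfolding Linf_norm_def by (rule esssup_I) (use le in auto)
qed

context decaying_solution
begin

text \<open>
  The integrand is the derivative of $\varphi\varphi'$, which vanishes at $+\infty$.
\<close>

lemma energy_integral:
  assumes V: "continuous_on UNIV V"
  shows "has_bochner_integral lborel (\<lambda>x. ((D x)\<^sup>2 + V x * (\<phi> x)\<^sup>2) * indicator {a..} x) (- (\<phi> a * D a))"
proof -
  let ?f = "\<lambda>x. (D x)\<^sup>2 + V x * (\<phi> x)\<^sup>2"
  have cont: "continuous_on UNIV ?f"
    by (intro continuous_intros cont_\<phi> cont_D V)
  have [measurable]: "?f \<in> borel_measurable borel"
    by (rule borel_measurable_continuous_onI[OF cont])
  have nonneg: "0 \<le> ?f x" for x
    using V_pos[of x] by (simp add: less_imp_le)
  have lim: "((\<lambda>x. \<phi> x * D x) \<longlongrightarrow> 0) at_top"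
    using tendsto_mult[OF \<phi>_tendsto D_tendsto] by simp
  have "(\<integral>\<^sup>+x. ennreal (?f x) * indicator {a..} x \<partial>lborel) = ennreal (0 - \<phi> a * D a)"
    by (rule nn_integral_FTC_atLeast[OF _ \<phi>D_deriv nonneg lim]) measurable
  moreover have "ennreal (?f x) * indicator {a..} x = ennreal (?f x * indicator {a..} x)" for x
    by (simp add: indicator_def)
  ultimately have "(\<integral>\<^sup>+x. ennreal (?f x * indicator {a..} x) \<partial>lborel) = ennreal (- (\<phi> a * D a))"
    by simp
  then show ?thesis
    by (intro has_bochner_integral_nn_integral) (use \<phi>D_nonpos[of a] nonneg in \<open>auto intro!: mult_nonneg_nonneg\<close>)
qed

end

locale decaying_pair =
  P: decaying_solution V \<phi>\<^sub>p D\<^sub>p v\<^sub>0 v\<^sub>1 +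
  M: decaying_solution "\<lambda>x. V (- x)" "\<lambda>x. \<phi>\<^sub>m (- x)" "\<lambda>x. - D\<^sub>m (- x)" v\<^sub>0 v\<^sub>1
  for V \<phi>\<^sub>p D\<^sub>p \<phi>\<^sub>m D\<^sub>m :: "real \<Rightarrow> real" and v\<^sub>0 v\<^sub>1 :: real +
  assumes V_cont: "continuous_on UNIV V"
begin

lemma reflected: "decaying_pair (\<lambda>x. V (- x)) (\<lambda>x. \<phi>\<^sub>m (- x)) (\<lambda>x. - D\<^sub>m (- x)) (\<lambda>x. \<phi>\<^sub>p (- x)) (\<lambda>x. - D\<^sub>p (- x)) v\<^sub>0 v\<^sub>1"
proof -
  have "continuous_on UNIV (\<lambda>x. V (- x))"
    by (rule continuous_on_compose2[OF V_cont]) (auto intro: continuous_intros)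
  then show ?thesis
    using P.decaying_solution_axioms M.decaying_solution_axioms
    by (simp add: decaying_pair_def decaying_pair_axioms_def)
qed

lemma \<phi>\<^sub>m_pos: "0 < \<phi>\<^sub>m x"
  using M.\<phi>_pos[of "- x"] by simp

lemma D\<^sub>m_pos: "0 < D\<^sub>m x"
  using M.D_neg[of "- x"] by simp

lemma \<phi>\<^sub>m_mono: "x \<le> y \<Longrightarrow> \<phi>\<^sub>m x \<le> \<phi>\<^sub>m y"
  using M.\<phi>_antimono[of "- y" "- x"] by simp

lemma \<phi>\<^sub>m_deriv: "(\<phi>\<^sub>m has_real_derivative D\<^sub>m x) (at x)"
  using DERIV_mirror[of "\<lambda>x. \<phi>\<^sub>m (- x)" "- D\<^sub>m x" x] M.\<phi>_deriv[of "- x"] by simp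

lemma D\<^sub>m_deriv: "(D\<^sub>m has_real_derivative V x * \<phi>\<^sub>m x) (at x)"
  using DERIV_minus[OF M.D_deriv[of "- x"]] DERIV_mirror[of "\<lambda>x. D\<^sub>m (- x)" "- (V x * \<phi>\<^sub>m x)" x] by simp

definition p :: "real \<Rightarrow> real" where "p x = D\<^sub>p x / \<phi>\<^sub>p x"
definition q :: "real \<Rightarrow> real" where "q x = D\<^sub>m x / \<phi>\<^sub>m x"

lemma p_neg: "p x < 0"
  using P.D_neg P.\<phi>_pos by (simp add: p_def divide_neg_pos)

lemma q_pos: "0 < q x"
  using D\<^sub>m_pos \<phi>\<^sub>m_pos by (simp add: q_def)

text \<open>
  The Riccati equation satisfied by the logarithmic derivative of a solution; \<open>q_deriv\<close> is the same
  for $\varphi_-$.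
\<close>

lemma p_deriv: "(p has_real_derivative V x - (p x)\<^sup>2) (at x)"
proof -
  have "(p has_real_derivative (V x * \<phi>\<^sub>p x * \<phi>\<^sub>p x - D\<^sub>p x * D\<^sub>p x) / (\<phi>\<^sub>p x * \<phi>\<^sub>p x)) (at x)"
    unfolding p_def[abs_def] using P.\<phi>_pos[of x] by (intro DERIV_divide P.\<phi>_deriv P.D_deriv) simp
  moreover have "(V x * \<phi>\<^sub>p x * \<phi>\<^sub>p x - D\<^sub>p x * D\<^sub>p x) / (\<phi>\<^sub>p x * \<phi>\<^sub>p x) = V x - (p x)\<^sup>2"
    using P.\<phi>_pos[of x] by (simp add: p_def field_simps power2_eq_square)
  ultimately show ?thesis by simp
qed

lemma q_deriv: "(q has_real_derivative V x - (q x)\<^sup>2) (at x)"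
proof -
  have "(q has_real_derivative (V x * \<phi>\<^sub>m x * \<phi>\<^sub>m x - D\<^sub>m x * D\<^sub>m x) / (\<phi>\<^sub>m x * \<phi>\<^sub>m x)) (at x)"
    unfolding q_def[abs_def] using \<phi>\<^sub>m_pos[of x] by (intro DERIV_divide \<phi>\<^sub>m_deriv D\<^sub>m_deriv) simp
  moreover have "(V x * \<phi>\<^sub>m x * \<phi>\<^sub>m x - D\<^sub>m x * D\<^sub>m x) / (\<phi>\<^sub>m x * \<phi>\<^sub>m x) = V x - (q x)\<^sup>2"
    using \<phi>\<^sub>m_pos[of x] by (simp add: q_def field_simps power2_eq_square)
  ultimately show ?thesis by simp
qed

text \<open>
  On $[-R,a]$ and $[a,R]$ the energy of $u$ is compared with that of the two branches of the
  minimiser.  The boundary terms at $a$ add up to $q(a) - p(a)$ because $u(a) = 1$; those at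
  $\pm R$ tend to zero because $|u| \le 1$ and the derivatives of the branches decay.
\<close>

lemma norm_V_sq_ge:
  assumes "u \<in> K a"
  shows "q a - p a \<le> norm_V_sq V u"
proof -
  from assms have u: "continuous_on UNIV u" and "u a = 1" and "Linf_norm u \<le> ereal 1"
    and u2: "integrable lborel (\<lambda>x. (u x)\<^sup>2)"
    by (auto simp: K_def H1_def L2_def one_ereal_def)
  then have u_le: "\<bar>u x\<bar> \<le> 1" for x
    using Linf_norm_le_iff by blast
  from assms obtain g where ug: "has_weak_deriv u g" and g2: "integrable lborel (\<lambda>x. (g x)\<^sup>2)"
    by (auto simp: K_def H1_def L2_def)
  have [measurable]: "u \<in> borel_measurable borel" "V \<in> borel_measurable borel" "g \<in> borel_measurable borel"
      "weak_deriv u \<in> borel_measurable borel"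
    using u V_cont has_weak_derivD(2)[OF ug] has_weak_derivD(2)[OF weak_deriv_AE_eq(1)[OF ug]]
    by (auto intro: borel_measurable_continuous_onI L1_locD(1))
  let ?f = "\<lambda>x. (g x)\<^sup>2 + V x * (u x)\<^sup>2"
  have nonneg: "0 \<le> ?f x" for x
    using P.V_pos[of x] by (simp add: less_imp_le)
  have "integrable lborel (\<lambda>x. V x * (u x)\<^sup>2)"
  proof (rule Bochner_Integration.integrable_bound[of lborel "\<lambda>x. v\<^sub>1 * (u x)\<^sup>2"])
    show "AE x in lborel. norm (V x * (u x)\<^sup>2) \<le> norm (v\<^sub>1 * (u x)\<^sup>2)"
    proof (rule AE_I2)
      fix x
      have "\<bar>V x\<bar> \<le> \<bar>v\<^sub>1\<bar>"
        using P.V_pos[of x] P.V_le[of x] by linarith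
      then show "norm (V x * (u x)\<^sup>2) \<le> norm (v\<^sub>1 * (u x)\<^sup>2)"
        by (simp add: abs_mult mult_right_mono)
    qed
  qed (use u2 in auto)
  with g2 have f_int: "integrable lborel ?f"
    by (rule Bochner_Integration.integrable_add)
  have norm_eq: "norm_V_sq V u = (\<integral>x. ?f x \<partial>lborel)"
    unfolding norm_V_sq_def
    by (rule integral_cong_AE) (use weak_deriv_AE_eq(2)[OF ug] in auto)

  let ?sm = "\<lambda>x. \<phi>\<^sub>m x / \<phi>\<^sub>m a" and ?dm = "\<lambda>x. D\<^sub>m x / \<phi>\<^sub>m a"
  let ?sp = "\<lambda>x. \<phi>\<^sub>p x / \<phi>\<^sub>p a" and ?dp = "\<lambda>x. D\<^sub>p x / \<phi>\<^sub>p a"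
  have sm: "(?sm has_real_derivative ?dm x) (at x)" "(?dm has_real_derivative V x * ?sm x) (at x)" for x
    using DERIV_cdivide[OF \<phi>\<^sub>m_deriv] DERIV_cdivide[OF D\<^sub>m_deriv] by auto
  have sp: "(?sp has_real_derivative ?dp x) (at x)" "(?dp has_real_derivative V x * ?sp x) (at x)" for x
    using DERIV_cdivide[OF P.\<phi>_deriv] DERIV_cdivide[OF P.D_deriv] by auto
  define low where "low R = (q a - p a) - 2 * (u (- R) * ?dm (- R)) + ?sm (- R) * ?dm (- R)
      + 2 * (u R * ?dp R) - ?sp R * ?dp R" for R
  have low_le: "low R \<le> norm_V_sq V u" if R: "\<bar>a\<bar> \<le> R" for R
  proof -
    \<comment> \<open>At \<open>a\<close> each branch contributes twice a boundary term from the inner product minus once the same term from its own energy.\<close>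
    have "2 * (u a * ?dm a - u (- R) * ?dm (- R)) - (?sm a * ?dm a - ?sm (- R) * ?dm (- R))
        \<le> (LINT t:{-R..a}|lborel. ?f t)"
      by (rule quadratic_form_lower_bound[OF ug u g2 V_cont less_imp_le[OF P.V_pos] sm]) (use R in simp)
    moreover have "2 * (u R * ?dp R - u a * ?dp a) - (?sp R * ?dp R - ?sp a * ?dp a)
        \<le> (LINT t:{a..R}|lborel. ?f t)"
      by (rule quadratic_form_lower_bound[OF ug u g2 V_cont less_imp_le[OF P.V_pos] sp]) (use R in simp)
    moreover have "?sm a = 1" "?sp a = 1" "?dm a = q a" "?dp a = p a"
      using \<phi>\<^sub>m_pos[of a] P.\<phi>_pos[of a] by (auto simp: p_def q_def)
    ultimately have "low R \<le> (LINT t:{-R..a}|lborel. ?f t) + (LINT t:{a..R}|lborel. ?f t)"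
      using \<open>u a = 1\<close> unfolding low_def by simp
    also have "\<dots> = (\<integral>t. indicator {-R..a} t *\<^sub>R ?f t + indicator {a..R} t *\<^sub>R ?f t \<partial>lborel)"
      unfolding set_lebesgue_integral_def
      by (intro Bochner_Integration.integral_add[symmetric] integrable_mult_indicator f_int) simp_all
    also have "\<dots> \<le> (\<integral>t. ?f t \<partial>lborel)"
    proof (rule integral_mono_AE)
      show "integrable lborel (\<lambda>t. indicator {-R..a} t *\<^sub>R ?f t + indicator {a..R} t *\<^sub>R ?f t)"
        by (intro Bochner_Integration.integrable_add integrable_mult_indicator f_int) simp_all
      have "AE x in lborel. x \<noteq> a"
        by (rule AE_lborel_singleton)
      then show "AE t in lborel. indicator {-R..a} t *\<^sub>R ?f t + indicator {a..R} t *\<^sub>R ?f t \<le> ?f t"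
      proof eventually_elim
        case (elim x)
        then show ?case
          using nonneg[of x] by (auto simp: indicator_def)
      qed
    qed fact
    finally show ?thesis
      unfolding norm_eq .
  qed
  have u0: "((\<lambda>R. u (r R) * d R) \<longlongrightarrow> 0) at_top" if "(d \<longlongrightarrow> 0) at_top" for r d :: "real \<Rightarrow> real"
  proof (rule tendsto_0_le[OF that, of _ 1])
    have "norm (u (r R) * d R) \<le> norm (d R) * 1" for R
      using mult_right_mono[OF u_le[of "r R"], of "\<bar>d R\<bar>"] by (simp add: abs_mult)
    then show "\<forall>\<^sub>F R in at_top. norm (u (r R) * d R) \<le> norm (d R) * 1"
      by simp
  qed
  have dm: "((\<lambda>R. ?dm (- R)) \<longlongrightarrow> 0) at_top"
    using tendsto_divide[OF tendsto_minus[OF M.D_tendsto] tendsto_const, of "\<phi>\<^sub>m a"] \<phi>\<^sub>m_pos[of a] by simp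
  have dp: "((\<lambda>R. ?dp R) \<longlongrightarrow> 0) at_top"
    using tendsto_divide[OF P.D_tendsto tendsto_const, of "\<phi>\<^sub>p a"] P.\<phi>_pos[of a] by simp
  have "((\<lambda>R. ?sm (- R)) \<longlongrightarrow> 0) at_top"
    using tendsto_divide[OF M.\<phi>_tendsto tendsto_const, of "\<phi>\<^sub>m a"] \<phi>\<^sub>m_pos[of a] by simp
  from tendsto_mult[OF this dm] have smdm: "((\<lambda>R. ?sm (- R) * ?dm (- R)) \<longlongrightarrow> 0) at_top"
    by simp
  have "((\<lambda>R. ?sp R) \<longlongrightarrow> 0) at_top"
    using tendsto_divide[OF P.\<phi>_tendsto tendsto_const, of "\<phi>\<^sub>p a"] P.\<phi>_pos[of a] by simp
  from tendsto_mult[OF this dp] have spdp: "((\<lambda>R. ?sp R * ?dp R) \<longlongrightarrow> 0) at_top"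
    by simp
  have "(low \<longlongrightarrow> (q a - p a) - 2 * 0 + 0 + 2 * 0 - 0) at_top"
    unfolding low_def[abs_def]
    by (rule tendsto_diff[OF tendsto_add[OF tendsto_add[OF tendsto_diff[OF tendsto_const
      tendsto_mult[OF tendsto_const u0[OF dm, of uminus]]] smdm] tendsto_mult[OF tendsto_const u0[OF dp, of "\<lambda>x. x"]]] spdp])
  moreover have "eventually (\<lambda>R. low R \<le> norm_V_sq V u) at_top"
    by (rule eventually_mono[OF eventually_ge_at_top[of "\<bar>a\<bar>"] low_le])
  ultimately have "(q a - p a) - 2 * 0 + 0 + 2 * 0 - 0 \<le> norm_V_sq V u"
    by (rule tendsto_upperbound) simp
  then show ?thesis by simp
qed

text \<open>
  The witness is $u_a$, glued from the two solutions normalised at $a$.  Its energy is the sum of the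
  two half-line energies, and $V \ge v_0 > 0$ turns finite energy into square integrability.
\<close>

lemma norm_V_sq_attained:
  obtains u where "u \<in> K a" "norm_V_sq V u = q a - p a"
proof -
  let ?sm = "\<lambda>x. \<phi>\<^sub>m x / \<phi>\<^sub>m a" and ?dm = "\<lambda>x. D\<^sub>m x / \<phi>\<^sub>m a"
  let ?sp = "\<lambda>x. \<phi>\<^sub>p x / \<phi>\<^sub>p a" and ?dp = "\<lambda>x. D\<^sub>p x / \<phi>\<^sub>p a"
  let ?u = "\<lambda>x. if x \<le> a then ?sm x else ?sp x"
  let ?g = "\<lambda>x. if x \<le> a then ?dm x else ?dp x"
  let ?f = "\<lambda>x. (?g x)\<^sup>2 + V x * (?u x)\<^sup>2"
  have cm: "continuous_on UNIV ?sm" "continuous_on UNIV ?dm"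
    using \<phi>\<^sub>m_pos[of a] by (auto intro!: continuous_intros continuous_on_of_DERIV[OF \<phi>\<^sub>m_deriv] continuous_on_of_DERIV[OF D\<^sub>m_deriv])
  have cp: "continuous_on UNIV ?sp" "continuous_on UNIV ?dp"
    using P.\<phi>_pos[of a] by (auto intro!: continuous_intros P.cont_\<phi> P.cont_D)
  have one: "?sm a = 1" "?sp a = 1"
    using \<phi>\<^sub>m_pos[of a] P.\<phi>_pos[of a] by auto
  have ug: "has_weak_deriv ?u ?g"
    by (rule has_weak_deriv_glue[OF DERIV_cdivide[OF \<phi>\<^sub>m_deriv] DERIV_cdivide[OF P.\<phi>_deriv] cm(2) cp(2)])
      (simp only: one)
  have "continuous_on ({..a} \<union> {a..}) ?u"
    by (rule continuous_on_If) (use one in \<open>auto intro: continuous_on_subset[OF cm(1)] continuous_on_subset[OF cp(1)]\<close>)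
  moreover have "{..a} \<union> {a..} = (UNIV :: real set)"
    by auto
  ultimately have cu: "continuous_on UNIV ?u"
    by simp
  have [measurable]: "?u \<in> borel_measurable borel" "?g \<in> borel_measurable borel" "V \<in> borel_measurable borel"
    "weak_deriv ?u \<in> borel_measurable borel"
    using V_cont has_weak_derivD(1,2)[OF ug, THEN L1_locD(1)] has_weak_derivD(2)[OF weak_deriv_AE_eq(1)[OF ug], THEN L1_locD(1)]
    by (auto intro: borel_measurable_continuous_onI)

  let ?em = "\<lambda>x. ((D\<^sub>m x)\<^sup>2 + V x * (\<phi>\<^sub>m x)\<^sup>2) * indicator {..a} x"
  let ?ep = "\<lambda>x. ((D\<^sub>p x)\<^sup>2 + V x * (\<phi>\<^sub>p x)\<^sup>2) * indicator {a..} x"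
  have ep: "has_bochner_integral lborel ?ep (- (\<phi>\<^sub>p a * D\<^sub>p a))"
    by (rule P.energy_integral[OF V_cont])
  have "continuous_on UNIV (\<lambda>x. V (- x))"
    by (rule continuous_on_compose2[OF V_cont]) (auto intro: continuous_intros)
  \<comment> \<open>The energy on the left half-line is that of the reflected solution on the right half-line.\<close>
  from M.energy_integral[OF this, of "- a"]
  have "has_bochner_integral lborel (\<lambda>x. ((D\<^sub>m (- x))\<^sup>2 + V (- x) * (\<phi>\<^sub>m (- x))\<^sup>2) * indicator {- a..} x) (\<phi>\<^sub>m a * D\<^sub>m a)"
    by simp
  moreover have "indicator {- a..} x = (indicator {..a} (- x) :: real)" for x :: real
    by (auto simp: indicator_def)
  ultimately have em: "has_bochner_integral lborel ?em (\<phi>\<^sub>m a * D\<^sub>m a)"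
    by (subst lborel_has_bochner_integral_real_affine_iff[where c="-1" and t=0]) simp_all
  have sum: "has_bochner_integral lborel (\<lambda>x. ?em x / (\<phi>\<^sub>m a)\<^sup>2 + ?ep x / (\<phi>\<^sub>p a)\<^sup>2)
      (\<phi>\<^sub>m a * D\<^sub>m a / (\<phi>\<^sub>m a)\<^sup>2 + - (\<phi>\<^sub>p a * D\<^sub>p a) / (\<phi>\<^sub>p a)\<^sup>2)"
    using \<phi>\<^sub>m_pos[of a] P.\<phi>_pos[of a]
    by (intro has_bochner_integral_add has_bochner_integral_divide em ep)
  have val: "\<phi>\<^sub>m a * D\<^sub>m a / (\<phi>\<^sub>m a)\<^sup>2 + - (\<phi>\<^sub>p a * D\<^sub>p a) / (\<phi>\<^sub>p a)\<^sup>2 = q a - p a"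
    using \<phi>\<^sub>m_pos[of a] P.\<phi>_pos[of a] by (simp add: p_def q_def power2_eq_square)
  have ae: "AE x in lborel. ?em x / (\<phi>\<^sub>m a)\<^sup>2 + ?ep x / (\<phi>\<^sub>p a)\<^sup>2 = ?f x"
  proof -
    have "AE x in lborel. x \<noteq> a"
      by (rule AE_lborel_singleton)
    then show ?thesis
    proof eventually_elim
      case (elim x)
      then show ?case
        by (auto simp: indicator_def power_divide add_divide_distrib)
    qed
  qed
  have f: "has_bochner_integral lborel ?f (q a - p a)"
    by (rule has_bochner_integralI_AE[OF sum[unfolded val] _ ae]) measurable
  then have f_int: "integrable lborel ?f"
    by (rule integrable.intros)
  have Vu: "v\<^sub>0 * (?u x)\<^sup>2 \<le> V x * (?u x)\<^sup>2" for x
    by (intro mult_right_mono P.V_ge) simp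
  have Vu0: "0 \<le> v\<^sub>0 * (?u x)\<^sup>2" for x
    using P.v\<^sub>0_pos by simp
  have "integrable lborel (\<lambda>x. v\<^sub>0 * (?u x)\<^sup>2)"
  proof (rule Bochner_Integration.integrable_bound[OF f_int])
    show "AE x in lborel. norm (v\<^sub>0 * (?u x)\<^sup>2) \<le> norm (?f x)"
    proof (rule AE_I2)
      fix x
      show "norm (v\<^sub>0 * (?u x)\<^sup>2) \<le> norm (?f x)"
        using Vu[of x] Vu0[of x] zero_le_power2[of "?g x"] unfolding real_norm_def by linarith
    qed
  qed measurable
  then have u2: "integrable lborel (\<lambda>x. (?u x)\<^sup>2)"
    using P.v\<^sub>0_pos by simp
  have g2: "integrable lborel (\<lambda>x. (?g x)\<^sup>2)"
  proof (rule Bochner_Integration.integrable_bound[OF f_int])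
    show "AE x in lborel. norm ((?g x)\<^sup>2) \<le> norm (?f x)"
    proof (rule AE_I2)
      fix x
      show "norm ((?g x)\<^sup>2) \<le> norm (?f x)"
        using Vu[of x] Vu0[of x] zero_le_power2[of "?g x"] unfolding real_norm_def by linarith
    qed
  qed measurable
  have u_le: "\<bar>?u x\<bar> \<le> 1" for x
    using \<phi>\<^sub>m_pos[of a] \<phi>\<^sub>m_pos[of x] P.\<phi>_pos[of a] P.\<phi>_pos[of x] \<phi>\<^sub>m_mono[of x a] P.\<phi>_antimono[of a x] by auto
  have "Linf_norm ?u \<le> ereal 1"
    unfolding Linf_norm_le_iff[OF cu] using u_le by blast
  moreover have "\<not> Linf_norm ?u < ereal 1"
  proof
    assume "Linf_norm ?u < ereal 1"
    then obtain r where r: "Linf_norm ?u < ereal r" "ereal r < ereal 1"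
      using ereal_dense2 by blast
    then have "\<bar>?u a\<bar> \<le> r"
      using Linf_norm_le_iff[OF cu, of r] less_imp_le by blast
    with r(2) one show False by simp
  qed
  ultimately have "Linf_norm ?u = 1"
    by (simp add: one_ereal_def)
  moreover have "?u \<in> L2" "?g \<in> L2"
    unfolding L2_def using u2 g2 by simp_all
  then have "?u \<in> H1"
    unfolding H1_def using ug cu by blast
  ultimately have "?u \<in> K a"
    unfolding K_def using one(1) by simp
  moreover have "norm_V_sq V ?u = (\<integral>x. ?f x \<partial>lborel)"
    unfolding norm_V_sq_def
    by (rule integral_cong_AE) (use weak_deriv_AE_eq(2)[OF ug] in auto)
  then have "norm_V_sq V ?u = q a - p a"
    using has_bochner_integral_integral_eq[OF f] by simp
  ultimately show ?thesis
    by (rule that)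
qed

lemma F_eq: "F V a = q a - p a"
proof -
  obtain u where "u \<in> K a" "norm_V_sq V u = q a - p a"
    by (rule norm_V_sq_attained)
  then show ?thesis
    unfolding F_def by (intro cInf_eq_minimum) (force intro: norm_V_sq_ge)+
qed

end

section \<open>Primitives of the reciprocal squares\<close>

context decaying_pair
begin

lemma wronskian_const: "D\<^sub>m x * \<phi>\<^sub>p x - \<phi>\<^sub>m x * D\<^sub>p x = D\<^sub>m y * \<phi>\<^sub>p y - \<phi>\<^sub>m y * D\<^sub>p y"
proof -
  have "((\<lambda>x. D\<^sub>m x * \<phi>\<^sub>p x - \<phi>\<^sub>m x * D\<^sub>p x) has_real_derivative 0) (at x)" for x
    by (auto intro!: derivative_eq_intros \<phi>\<^sub>m_deriv D\<^sub>m_deriv P.\<phi>_deriv P.D_deriv)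
  then show ?thesis
    using DERIV_isconst_all[of "\<lambda>x. D\<^sub>m x * \<phi>\<^sub>p x - \<phi>\<^sub>m x * D\<^sub>p x"] by simp
qed

text \<open>
  By constancy of the Wronskian $W$, the derivative of $-\varphi_+/(W\varphi_-)$ is $1/\varphi_-^2$.
  This primitive vanishes at $+\infty$, where $\varphi_+$ tends to zero and $\varphi_-$ stays above
  $\varphi_-(0) = 1$.  Finally $W = \varphi_+\varphi_-(q-p)$.
\<close>

lemma H_minus_eq: "H_minus \<phi>\<^sub>m x = 1 / ((\<phi>\<^sub>m x)\<^sup>2 * (q x - p x))"
proof -
  define W where "W = D\<^sub>m x * \<phi>\<^sub>p x - \<phi>\<^sub>m x * D\<^sub>p x"
  have W: "D\<^sub>m y * \<phi>\<^sub>p y - \<phi>\<^sub>m y * D\<^sub>p y = W" for y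
    unfolding W_def by (rule wronskian_const)
  have W_eq: "W = \<phi>\<^sub>m x * \<phi>\<^sub>p x * (q x - p x)"
    using \<phi>\<^sub>m_pos[of x] P.\<phi>_pos[of x] by (simp add: W_def p_def q_def field_simps)
  have "0 < q x - p x"
    using p_neg[of x] q_pos[of x] by simp
  then have W_pos: "0 < W"
    unfolding W_eq using \<phi>\<^sub>m_pos[of x] P.\<phi>_pos[of x] by simp
  have nonzero: "\<phi>\<^sub>m y \<noteq> 0" for y
    using \<phi>\<^sub>m_pos[of y] by simp
  have cont: "continuous_on UNIV (\<lambda>y. 1 / (\<phi>\<^sub>m y)\<^sup>2)"
    by (intro continuous_intros continuous_on_of_DERIV[OF \<phi>\<^sub>m_deriv]) (simp add: nonzero)
  have deriv: "((\<lambda>y. - (\<phi>\<^sub>p y / \<phi>\<^sub>m y) / W) has_real_derivative 1 / (\<phi>\<^sub>m y)\<^sup>2) (at y)" for y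
  proof -
    have "((\<lambda>y. - (\<phi>\<^sub>p y / \<phi>\<^sub>m y) / W) has_real_derivative
        - ((D\<^sub>p y * \<phi>\<^sub>m y - \<phi>\<^sub>p y * D\<^sub>m y) / (\<phi>\<^sub>m y * \<phi>\<^sub>m y)) / W) (at y)"
      using \<phi>\<^sub>m_pos[of y] by (intro DERIV_cdivide DERIV_minus DERIV_divide P.\<phi>_deriv \<phi>\<^sub>m_deriv) simp
    moreover have "- (D\<^sub>p y * \<phi>\<^sub>m y - \<phi>\<^sub>p y * D\<^sub>m y) = W"
      using W[of y] by (simp add: mult.commute)
    then have "- ((D\<^sub>p y * \<phi>\<^sub>m y - \<phi>\<^sub>p y * D\<^sub>m y) / (\<phi>\<^sub>m y * \<phi>\<^sub>m y)) / W = 1 / (\<phi>\<^sub>m y)\<^sup>2"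
      using W_pos by (simp only: minus_divide_left) (simp add: power2_eq_square)
    ultimately show ?thesis by simp
  qed
  have "((\<lambda>y. \<phi>\<^sub>p y / \<phi>\<^sub>m y) \<longlongrightarrow> 0) at_top"
  proof (rule tendsto_0_le[OF P.\<phi>_tendsto, of _ 1])
    have "norm (\<phi>\<^sub>p y / \<phi>\<^sub>m y) \<le> norm (\<phi>\<^sub>p y) * 1" if "0 \<le> y" for y
    proof -
      have "1 \<le> \<phi>\<^sub>m y"
        using \<phi>\<^sub>m_mono[OF that] M.\<phi>_0 by simp
      then show ?thesis
        using P.\<phi>_pos[of y] \<phi>\<^sub>m_pos[of y] by (simp add: field_simps)
    qed
    then show "\<forall>\<^sub>F y in at_top. norm (\<phi>\<^sub>p y / \<phi>\<^sub>m y) \<le> norm (\<phi>\<^sub>p y) * 1"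
      by (rule eventually_mono[OF eventually_ge_at_top[of 0]])
  qed
  from tendsto_divide[OF tendsto_minus[OF this] tendsto_const, of W]
  have lim: "((\<lambda>y. - (\<phi>\<^sub>p y / \<phi>\<^sub>m y) / W) \<longlongrightarrow> 0) at_top"
    using W_pos by simp
  have "(\<integral>\<^sup>+y. ennreal (1 / (\<phi>\<^sub>m y)\<^sup>2) * indicator {x..} y \<partial>lborel) = ennreal (0 - - (\<phi>\<^sub>p x / \<phi>\<^sub>m x) / W)"
    by (rule nn_integral_FTC_atLeast[OF borel_measurable_continuous_onI[OF cont] deriv _ lim]) simp
  moreover have "ennreal (1 / (\<phi>\<^sub>m y)\<^sup>2) * indicator {x..} y = ennreal (indicator {x..} y *\<^sub>R (1 / (\<phi>\<^sub>m y)\<^sup>2))" for y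
    by (simp add: indicator_def)
  ultimately have nn: "(\<integral>\<^sup>+y. ennreal (indicator {x..} y *\<^sub>R (1 / (\<phi>\<^sub>m y)\<^sup>2)) \<partial>lborel) = ennreal (\<phi>\<^sub>p x / \<phi>\<^sub>m x / W)"
    by simp
  have [measurable]: "(\<lambda>y. 1 / (\<phi>\<^sub>m y)\<^sup>2) \<in> borel_measurable borel"
    by (rule borel_measurable_continuous_onI[OF cont])
  have "has_bochner_integral lborel (\<lambda>y. indicator {x..} y *\<^sub>R (1 / (\<phi>\<^sub>m y)\<^sup>2)) (\<phi>\<^sub>p x / \<phi>\<^sub>m x / W)"
  proof (rule has_bochner_integral_nn_integral[OF _ _ _ nn])
    show "0 \<le> \<phi>\<^sub>p x / \<phi>\<^sub>m x / W"
      using P.\<phi>_pos[of x] \<phi>\<^sub>m_pos[of x] W_pos by simp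
    show "(\<lambda>y. indicator {x..} y *\<^sub>R (1 / (\<phi>\<^sub>m y)\<^sup>2)) \<in> borel_measurable lborel"
      by measurable
  qed (simp add: indicator_def)
  then have "H_minus \<phi>\<^sub>m x = \<phi>\<^sub>p x / \<phi>\<^sub>m x / W"
    unfolding H_minus_def h_def set_lebesgue_integral_def by (rule has_bochner_integral_integral_eq)
  then show ?thesis
    unfolding W_eq using P.\<phi>_pos[of x] by (simp add: power2_eq_square)
qed

lemma H_plus_eq: "H_plus \<phi>\<^sub>p x = 1 / ((\<phi>\<^sub>p x)\<^sup>2 * (q x - p x))"
proof -
  interpret R: decaying_pair "\<lambda>x. V (- x)" "\<lambda>x. \<phi>\<^sub>m (- x)" "\<lambda>x. - D\<^sub>m (- x)" "\<lambda>x. \<phi>\<^sub>p (- x)" "\<lambda>x. - D\<^sub>p (- x)" v\<^sub>0 v\<^sub>1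
    by (rule reflected)
  have "indicator {..x} (- y) = (indicator {- x..} y :: real)" for y
    by (auto simp: indicator_def)
  then have "H_plus \<phi>\<^sub>p x = H_minus (\<lambda>x. \<phi>\<^sub>p (- x)) (- x)"
    unfolding H_plus_def H_minus_def h_def set_lebesgue_integral_def
    by (subst lborel_integral_real_affine[where c="-1" and t=0]) simp_all
  then show ?thesis
    unfolding R.H_minus_eq by (simp add: R.p_def R.q_def p_def q_def add.commute)
qed

lemma deriv_h_times_H_minus: "deriv (h \<phi>\<^sub>m) x * H_minus \<phi>\<^sub>m x = 2 * q x / (q x - p x)"
proof -
  have "(h \<phi>\<^sub>m has_real_derivative 2 * \<phi>\<^sub>m x * D\<^sub>m x) (at x)"
    unfolding h_def[abs_def] using DERIV_power[OF \<phi>\<^sub>m_deriv[of x], of 2] by (simp add: algebra_simps)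
  then have "deriv (h \<phi>\<^sub>m) x = 2 * (\<phi>\<^sub>m x)\<^sup>2 * q x"
    using \<phi>\<^sub>m_pos[of x] by (simp add: DERIV_imp_deriv q_def power2_eq_square)
  then show ?thesis
    using \<phi>\<^sub>m_pos[of x] by (simp add: H_minus_eq)
qed

lemma deriv_h_times_H_plus: "deriv (h \<phi>\<^sub>p) x * H_plus \<phi>\<^sub>p x = 2 * p x / (q x - p x)"
proof -
  have "(h \<phi>\<^sub>p has_real_derivative 2 * \<phi>\<^sub>p x * D\<^sub>p x) (at x)"
    unfolding h_def[abs_def] using DERIV_power[OF P.\<phi>_deriv[of x], of 2] by (simp add: algebra_simps)
  then have "deriv (h \<phi>\<^sub>p) x = 2 * (\<phi>\<^sub>p x)\<^sup>2 * p x"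
    using P.\<phi>_pos[of x] by (simp add: DERIV_imp_deriv p_def power2_eq_square)
  then show ?thesis
    using P.\<phi>_pos[of x] by (simp add: H_plus_eq)
qed

section \<open>Critical points of the minimal energy\<close>

lemma deriv_ell\<^sub>p: "deriv (ell \<phi>\<^sub>p) = p"
proof
  fix x
  have "(ell \<phi>\<^sub>p has_real_derivative p x) (at x)"
    unfolding ell_def[abs_def] p_def using P.\<phi>_pos[of x] by (auto intro!: derivative_eq_intros P.\<phi>_deriv simp: field_simps)
  then show "deriv (ell \<phi>\<^sub>p) x = p x"
    by (rule DERIV_imp_deriv)
qed

lemma deriv_ell\<^sub>m: "deriv (ell \<phi>\<^sub>m) = q"
proof
  fix x
  have "(ell \<phi>\<^sub>m has_real_derivative q x) (at x)"
    unfolding ell_def[abs_def] q_def using \<phi>\<^sub>m_pos[of x] by (auto intro!: derivative_eq_intros \<phi>\<^sub>m_deriv simp: field_simps)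
  then show "deriv (ell \<phi>\<^sub>m) x = q x"
    by (rule DERIV_imp_deriv)
qed

lemma deriv_p: "deriv p x = V x - (p x)\<^sup>2"
  by (rule DERIV_imp_deriv[OF p_deriv])

lemma deriv_q: "deriv q x = V x - (q x)\<^sup>2"
  by (rule DERIV_imp_deriv[OF q_deriv])

lemma deriv_F: "deriv (F V) = (\<lambda>x. (p x)\<^sup>2 - (q x)\<^sup>2)"
proof
  fix x
  have "F V = (\<lambda>a. q a - p a)"
    by (rule ext) (rule F_eq)
  then have "(F V has_real_derivative (p x)\<^sup>2 - (q x)\<^sup>2) (at x)"
    using DERIV_diff[OF q_deriv p_deriv, of x] by simp
  then show "deriv (F V) x = (p x)\<^sup>2 - (q x)\<^sup>2"
    by (rule DERIV_imp_deriv)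
qed

lemma deriv2_F: "deriv (deriv (F V)) x = 2 * p x * (V x - (p x)\<^sup>2) - 2 * q x * (V x - (q x)\<^sup>2)"
  unfolding deriv_F
  by (rule DERIV_imp_deriv) (auto intro!: derivative_eq_intros p_deriv q_deriv)

text \<open>
  The root $p = q$ of $p^2 = q^2$ is excluded by the signs of $p$ and $q$.  At $p = -q$ the second
  derivative factors as $4q(q^2 - V)$ with $q > 0$.
\<close>

lemma critical_iff: "deriv (F V) x = 0 \<and> 0 \<le> deriv (deriv (F V)) x \<longleftrightarrow> p x = - q x \<and> V x \<le> (q x)\<^sup>2"
proof -
  have "(p x)\<^sup>2 = (q x)\<^sup>2 \<longleftrightarrow> p x = - q x"
    using p_neg[of x] q_pos[of x] by (auto simp: power2_eq_iff)
  moreover have "0 \<le> deriv (deriv (F V)) x \<longleftrightarrow> V x \<le> (q x)\<^sup>2" if "p x = - q x"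
  proof -
    have "deriv (deriv (F V)) x = 4 * q x * ((q x)\<^sup>2 - V x)"
      unfolding deriv2_F that by (simp add: algebra_simps)
    then show ?thesis
      using q_pos[of x] by (simp add: zero_le_mult_iff)
  qed
  ultimately show ?thesis
    unfolding deriv_F by auto
qed

end

theorem theorem5p2:
  fixes V \<phi>\<^sub>p \<phi>\<^sub>m :: "real \<Rightarrow> real" and v\<^sub>0 v\<^sub>1 a :: real
  assumes "V \<in> Linf" and "continuous_on UNIV V"
    and "0 < v\<^sub>0" and "\<And>x. v\<^sub>0 \<le> V x" and "\<And>x. V x \<le> v\<^sub>1"
    and "is_phi_plus V \<phi>\<^sub>p" and "is_phi_minus V \<phi>\<^sub>m"
  shows "((deriv (F V) a = 0 \<and> deriv (deriv (F V)) a \<ge> 0) \<longleftrightarrow>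
            (- deriv (ell \<phi>\<^sub>p) a = deriv (ell \<phi>\<^sub>m) a \<and> deriv (ell \<phi>\<^sub>m) a \<ge> sqrt (V a))) \<and>
         ((deriv (F V) a = 0 \<and> deriv (deriv (F V)) a \<ge> 0) \<longleftrightarrow>
            (deriv (h \<phi>\<^sub>p) a * H_plus \<phi>\<^sub>p a = -1 \<and> deriv (deriv (ell \<phi>\<^sub>p)) a \<le> 0)) \<and>
         ((deriv (F V) a = 0 \<and> deriv (deriv (F V)) a \<ge> 0) \<longleftrightarrow>
            (deriv (h \<phi>\<^sub>m) a * H_minus \<phi>\<^sub>m a = 1 \<and> deriv (deriv (ell \<phi>\<^sub>m)) a \<le> 0))"
proof -
  from assms(6) have p: "solves_ode V \<phi>\<^sub>p" "\<phi>\<^sub>p 0 = 1" "(\<phi>\<^sub>p \<longlongrightarrow> 0) at_top"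
    by (auto simp: is_phi_plus_def)
  from assms(7) have m: "solves_ode V \<phi>\<^sub>m" "\<phi>\<^sub>m 0 = 1" "(\<phi>\<^sub>m \<longlongrightarrow> 0) at_bot"
    by (auto simp: is_phi_minus_def)
  obtain D\<^sub>p where D\<^sub>p: "\<And>x. (\<phi>\<^sub>p has_real_derivative D\<^sub>p x) (at x)" "\<And>x. (D\<^sub>p has_real_derivative V x * \<phi>\<^sub>p x) (at x)"
    by (rule solves_ode_classical[OF assms(2) p(1)]) (rule that)
  obtain D\<^sub>m where D\<^sub>m: "\<And>x. (\<phi>\<^sub>m has_real_derivative D\<^sub>m x) (at x)" "\<And>x. (D\<^sub>m has_real_derivative V x * \<phi>\<^sub>m x) (at x)"
    by (rule solves_ode_classical[OF assms(2) m(1)]) (rule that)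
  interpret decaying_pair V \<phi>\<^sub>p D\<^sub>p \<phi>\<^sub>m D\<^sub>m v\<^sub>0 v\<^sub>1
  proof unfold_locales
    show "((\<lambda>x. \<phi>\<^sub>m (- x)) has_real_derivative - D\<^sub>m (- x)) (at x)" for x
      using D\<^sub>m(1)[of "- x"] by (simp add: DERIV_mirror)
    show "((\<lambda>x. - D\<^sub>m (- x)) has_real_derivative V (- x) * \<phi>\<^sub>m (- x)) (at x)" for x
      using DERIV_minus[of "\<lambda>x. D\<^sub>m (- x)" "- (V (- x) * \<phi>\<^sub>m (- x))" x] D\<^sub>m(2)[of "- x"] by (simp add: DERIV_mirror)
    show "((\<lambda>x. \<phi>\<^sub>m (- x)) \<longlongrightarrow> 0) at_top"
      using m(3) by (simp add: filterlim_at_bot_mirror)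
  qed (use assms p m D\<^sub>p in auto)
  have pq: "p a < 0" "0 < q a"
    by (rule p_neg, rule q_pos)
  have "sqrt (V a) \<le> q a \<longleftrightarrow> V a \<le> (q a)\<^sup>2"
    using pq P.V_pos[of a] real_le_rsqrt real_sqrt_le_iff[of "V a" "(q a)\<^sup>2"] by simp
  moreover have "2 * p a / (q a - p a) = - 1 \<longleftrightarrow> p a = - q a" "2 * q a / (q a - p a) = 1 \<longleftrightarrow> p a = - q a"
    using pq by (auto simp: field_simps)
  ultimately show ?thesis
    unfolding critical_iff deriv_ell\<^sub>p deriv_ell\<^sub>m deriv_p deriv_q deriv_h_times_H_plus deriv_h_times_H_minus by auto
qed

end
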